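(* Let $(\alpha_n)_{n\ge 1}$ be a sequence in $(0,1)$ with $\lim_{n\to\infty} n\alpha_n=\alpha$ for some $\alpha\in(0,1)$, and let $c_n\in\mathbb{R}$ be defined by $\Phi(-c_n)=\alpha_n$. For $\rho\in[0,1]$ let $$H_n(\rho)=P\big(X_i\le c_n \text{ for all } i=1,\dots,n\big),$$ where $(X_1,\dots,X_n)$ is jointly normal with $X_i\sim N(0,1)$ for all $i$ and $\mathrm{Corr}(X_i,X_j)=\rho$ for all $i\ne j$. Then $H_n''(\rho)\le 0$ asymptotically as $n\to\infty$, i.e. for every $\rho\in(0,1)$ there is $N$ such that $H_n''(\rho)\le 0$ for all $n\ge N$; and hence $H_n$ is asymptotically a concave function on $[0,1]$, i.e. for all $\rho_1,\rho_2\in[0,1]$ and $t\in[0,1]$ there is $N$ such that for all $n\ge N$ $$H_n\big(t\rho_1+(1-t)\rho_2\big)\ \ge\ t\,H_n(\rho_1)+(1-t)\,H_n(\rho_2).$$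
   Context: $\Phi$ is the cumulative distribution function of $N(0,1)$. Setting: the null hypotheses are $H_{0i}:X_i\sim N(0,1)$, $i=1,\dots,n$; each $H_{0i}$ is tested at size $\alpha_n$ and is rejected when $X_i>c_n$. The family wise error rate is $\mathrm{FWER}_n(\rho)=P(X_i>c_n\text{ for some } i\le n)=1-H_n(\rho)$, computed under the intersection of all null hypotheses. Primes denote derivatives with respect to $\rho$. *)

theory Defs
  imports "HOL-Probability.Probability"
begin

(* The second disjunct is N(m, 0): point masses count as normal laws, so that singular
   Gaussian vectors (in particular perfectly correlated ones) are included below. *)
definition normal_rv :: "'a measure \<Rightarrow> ('a \<Rightarrow> real) \<Rightarrow> bool" where
  "normal_rv M Y \<longleftrightarrow>
     (\<exists>m s. s > 0 \<and> distributed M lborel Y (normal_density m s)) \<or>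
     (Y \<in> borel_measurable M \<and> (\<exists>m. AE \<omega> in M. Y \<omega> = m))"

definition jointly_normal :: "'a measure \<Rightarrow> 'i set \<Rightarrow> ('i \<Rightarrow> 'a \<Rightarrow> real) \<Rightarrow> bool" where
  "jointly_normal M I X \<longleftrightarrow>
     (\<forall>a :: 'i \<Rightarrow> real. normal_rv M (\<lambda>\<omega>. \<Sum>i\<in>I. a i * X i \<omega>))"

definition covariance :: "'a measure \<Rightarrow> ('a \<Rightarrow> real) \<Rightarrow> ('a \<Rightarrow> real) \<Rightarrow> real" where
  "covariance M Y Z =
     (\<integral>\<omega>. (Y \<omega> - (\<integral>x. Y x \<partial>M)) * (Z \<omega> - (\<integral>x. Z x \<partial>M)) \<partial>M)"

definition correlation :: "'a measure \<Rightarrow> ('a \<Rightarrow> real) \<Rightarrow> ('a \<Rightarrow> real) \<Rightarrow> real" where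
  "correlation M Y Z = covariance M Y Z / (sqrt (covariance M Y Y) * sqrt (covariance M Z Z))"

definition equicorrelated_std_normal ::
    "'a measure \<Rightarrow> nat \<Rightarrow> real \<Rightarrow> (nat \<Rightarrow> 'a \<Rightarrow> real) \<Rightarrow> bool" where
  "equicorrelated_std_normal M n \<rho> X \<longleftrightarrow>
     prob_space M \<and>
     jointly_normal M {1..n} X \<and>
     (\<forall>i\<in>{1..n}. distributed M lborel (X i) std_normal_density) \<and>
     (\<forall>i\<in>{1..n}. \<forall>j\<in>{1..n}. i \<noteq> j \<longrightarrow> correlation M (X i) (X j) = \<rho>)"

end

theory Submission
  imports Defs "HOL-Real_Asymp.Real_Asymp"
begin

text \<open>
  Write \<open>X\<^sub>i = sqrt \<rho> * Z + sqrt (1 - \<rho>) * \<epsilon>\<^sub>i\<close> with independent standard normal \<open>Z, \<epsilon>\<^sub>1, \<dots>, \<epsilon>\<^sub>n\<close>.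
  Given \<open>Z = z\<close> the \<open>X\<^sub>i\<close> are independent, so \<open>H\<^sub>n(\<rho>) = 1 - F\<^sub>n(\<rho>)\<close>, where the family wise error rate
  \<open>F\<^sub>n(\<rho>)\<close> is the mean over \<open>z\<close> of the conditional rejection probability
  \<open>p(z) = 1 - \<Phi>((c\<^sub>n - sqrt \<rho> * z) / sqrt (1 - \<rho>)) ^ n\<close>.  The threshold \<open>c\<^sub>n\<close> tends to infinity and
  \<open>n * (1 - \<Phi>(c\<^sub>n))\<close> stays near \<open>\<alpha>\<close>, so rejection becomes likely exactly when
  \<open>(c\<^sub>n - sqrt \<rho> * z) / sqrt (1 - \<rho>)\<close> falls below \<open>c\<^sub>n\<close>, that is, when \<open>z \<ge> \<kappa> * c\<^sub>n\<close> with
  \<open>\<kappa> = (1 - sqrt (1 - \<rho>)) / sqrt \<rho> = sqrt \<rho> / (1 + sqrt (1 - \<rho>))\<close>.  Hence \<open>F\<^sub>n(\<rho>)\<close> is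
  \<open>exp (- \<kappa>\<^sup>2 * c\<^sub>n\<^sup>2 / 2)\<close> up to factors \<open>exp (O(c\<^sub>n))\<close>; the two halves of this estimate are
  \<open>fwer_ge\<close> (one tail interval of length 1 beyond \<open>\<kappa> * c\<^sub>n\<close>) and \<open>fwer_le\<close> (an exponential bound on \<open>p\<close>,
  integrated with the Gaussian moment generating function).

  For the second derivative, take \<open>u = (c\<^sub>n - sqrt \<rho> * z) / sqrt (1 - \<rho>)\<close> as integration variable.  Then
  \<open>\<rho>\<close> enters only through a Gaussian density in \<open>u\<close>, and differentiating it twice multiplies it by a
  quartic polynomial in \<open>z\<close>.  Up to a positive factor this polynomial is \<open>z\<^sup>2 * (z - sqrt \<rho> * c\<^sub>n)\<^sup>2\<close> plus
  terms of lower order, so it is at least 1 except for \<open>z\<close> within a fixed distance of \<open>0\<close> or of \<open>sqrt \<rho> * c\<^sub>n\<close>, where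
  it is at worst of order \<open>- c\<^sub>n\<^sup>2\<close> (\<open>curvature_poly_ge\<close>).  Near \<open>0\<close> rejection has probability at most
  \<open>exp (- \<kappa>\<^sup>2 * c\<^sub>n\<^sup>2 + O(c\<^sub>n))\<close>, and being near \<open>sqrt \<rho> * c\<^sub>n\<close> has Gaussian probability at most
  \<open>exp (- \<rho> * c\<^sub>n\<^sup>2 / 2 + O(c\<^sub>n))\<close>.  As \<open>0 < \<kappa> < sqrt \<rho>\<close>, both are negligible compared with \<open>F\<^sub>n(\<rho>)\<close>, whence
  \<open>F\<^sub>n'' \<ge> 0\<close> eventually.

  The threshold index obtained this way depends on \<open>\<rho>\<close>, so concavity along a chord is not deduced from the second derivative.
  Instead, \<open>\<kappa>\<close> is strictly increasing in \<open>\<rho>\<close>, so for \<open>\<rho>\<^sub>1 < m < 1\<close> the ratio \<open>F\<^sub>n(m) / F\<^sub>n(\<rho>\<^sub>1)\<close> tends to \<open>0\<close>;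
  eventually \<open>F\<^sub>n(m) \<le> t * F\<^sub>n(\<rho>\<^sub>1) \<le> t * F\<^sub>n(\<rho>\<^sub>1) + (1 - t) * F\<^sub>n(\<rho>\<^sub>2)\<close>.

  The one-factor representation itself is a statement about laws.  Joint normality and the correlations determine the
  expected cosine of every linear combination of the \<open>X\<^sub>i\<close>, and these determine the orthant probability
  (\<open>orthant_probability_determined_by_cosines\<close>), which may therefore be computed in the one-factor model.
\<close>

abbreviation gauss :: "real measure" where "gauss \<equiv> std_normal_distribution"
abbreviation \<Phi> :: "real \<Rightarrow> real" where "\<Phi> \<equiv> cdf gauss"
abbreviation \<phi> :: "real \<Rightarrow> real" where "\<phi> \<equiv> std_normal_density"

section \<open>Orthant probabilities and expected cosines\<close>


lemma integral_cos_std_normal: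
  "(\<integral>x. cos (t * x + b) \<partial>std_normal_distribution) = cos b * exp (- t\<^sup>2 / 2)"
proof -
  interpret N: real_distribution std_normal_distribution by (rule real_dist_normal_dist)
  have int: "integrable std_normal_distribution (\<lambda>x. iexp (t * x))"
    by (intro N.integrable_const_bound[where B = 1]) auto
  have "(\<integral>x. cos (t * x + b) \<partial>std_normal_distribution)
      = (\<integral>x. Re (iexp b * iexp (t * x)) \<partial>std_normal_distribution)"
    by (intro Bochner_Integration.integral_cong refl)
       (simp add: cis_mult add.commute flip: cis_conv_exp of_real_mult)
  also have "\<dots> = Re (iexp b * char std_normal_distribution t)"
    using int by (subst integral_Re) (auto simp: char_def)
  also have "\<dots> = cos b * exp (- t\<^sup>2 / 2)"
  proof -
    have "Re (iexp b * complex_of_real r) = cos b * r" for r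
      by (simp flip: cis_conv_exp)
    then show ?thesis by (simp only: char_std_normal_distribution)
  qed
  finally show ?thesis .
qed

text \<open>
  Normalised by its total mass, the weight \<open>W\<close> turns the law of \<open>Y\<close> into a probability measure on the line.
  Cosines with a phase contain the sines, so the hypothesis fixes the characteristic function of that measure, and
  Levy's uniqueness theorem applies.  If the total mass is 0, the weights vanish almost everywhere.
\<close>

lemma weighted_cdf_determined_by_cosines:
  fixes W Y :: "'a \<Rightarrow> real" and W' Y' :: "'b \<Rightarrow> real"
  assumes M: "prob_space M" "prob_space M'"
    and meas: "W \<in> borel_measurable M" "Y \<in> borel_measurable M"
              "W' \<in> borel_measurable M'" "Y' \<in> borel_measurable M'"
    and W: "\<And>x. 0 \<le> W x" "\<And>x. W x \<le> B" and W': "\<And>x. 0 \<le> W' x" "\<And>x. W' x \<le> B"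
    and eq: "\<And>t b. (\<integral>x. W x * cos (t * Y x + b) \<partial>M) = (\<integral>x. W' x * cos (t * Y' x + b) \<partial>M')"
  shows "(\<integral>x. W x * indicator {..y} (Y x) \<partial>M) = (\<integral>x. W' x * indicator {..y} (Y' x) \<partial>M')"
proof -
  interpret M: prob_space M by fact
  interpret M': prob_space M' by fact
  note [measurable] = meas
  define m where "m = (\<integral>x. W x \<partial>M)"
  have m': "m = (\<integral>x. W' x \<partial>M')" using eq[of 0 0] by (simp add: m_def)
  have bd: "\<bar>W x\<bar> \<le> B" "\<bar>W' x'\<bar> \<le> B" for x x'
    using W[of x] W'[of x'] by auto
  have int: "integrable M W" "integrable M' W'"
    using bd by (auto intro!: M.integrable_const_bound[where B = B] M'.integrable_const_bound[where B = B])
  have m0: "0 \<le> m" unfolding m_def using W by simp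
  show ?thesis
  proof (cases "m = 0")
    case True
    have "AE x in M. W x = 0" "AE x in M'. W' x = 0"
      using True int W W' integral_nonneg_eq_0_iff_AE[of M W] integral_nonneg_eq_0_iff_AE[of M' W']
      by (auto simp flip: m_def m')
    then have "(\<integral>x. W x * indicator {..y} (Y x) \<partial>M) = (\<integral>x. 0 \<partial>M)"
      "(\<integral>x. W' x * indicator {..y} (Y' x) \<partial>M') = (\<integral>x. 0 \<partial>M')"
      by (intro integral_cong_AE; auto)+
    then show ?thesis by simp
  next
    case False
    with m0 have mpos: "0 < m" by simp
    define D where "D = distr (density M (\<lambda>x. ennreal (W x / m))) borel Y"
    define D' where "D' = distr (density M' (\<lambda>x. ennreal (W' x / m))) borel Y'"
    have one: "(\<integral>\<^sup>+x. ennreal (W x / m) \<partial>M) = 1" "(\<integral>\<^sup>+x. ennreal (W' x / m) \<partial>M') = 1"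
      using int W W' mpos m_def m' by (subst nn_integral_eq_integral; simp)+
    have rd: "real_distribution D" "real_distribution D'"
      unfolding D_def D'_def using one
      by (auto intro!: prob_space.real_distribution_distr prob_spaceI simp: emeasure_density
          cong: nn_integral_cong)
    have integD: "(\<integral>x. f x \<partial>D) = (\<integral>x. (W x / m) *\<^sub>R f (Y x) \<partial>M)"
      "(\<integral>x. f x \<partial>D') = (\<integral>x. (W' x / m) *\<^sub>R f (Y' x) \<partial>M')"
      if [measurable]: "f \<in> borel_measurable borel" for f :: "real \<Rightarrow> 'c::{banach, second_countable_topology}"
      unfolding D_def D'_def using W W' mpos
      by (auto simp: integral_distr integral_density)
    have "char D = char D'"
    proof
      fix t
      have bound: "\<bar>W x\<bar> * \<bar>cos z\<bar> \<le> B" "\<bar>W' x'\<bar> * \<bar>cos z\<bar> \<le> B" for x x' z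
        using mult_left_le[OF abs_cos_le_one abs_ge_zero] bd order_trans by blast+
      have intI: "integrable M (\<lambda>x. W x / m * cos (t * Y x + b))"
                 "integrable M' (\<lambda>x. W' x / m * cos (t * Y' x + b))" for b
        using bound mpos
        by (auto intro!: M.integrable_const_bound[where B = "B/m"] M'.integrable_const_bound[where B = "B/m"] AE_I2
            divide_right_mono simp: abs_mult)
      have eqm: "(\<integral>x. W x / m * cos (t * Y x + b) \<partial>M) = (\<integral>x. W' x / m * cos (t * Y' x + b) \<partial>M')" for b
        using eq[of t b] by simp
      (* the sine is the cosine with phase - pi / 2 *)
      have *: "(v::real) *\<^sub>R iexp z = complex_of_real (v * cos (z + 0)) + \<i> * complex_of_real (v * cos (z + (- pi/2)))" for v z
        by (simp add: cos_diff complex_eq_iff cis.ctr flip: cis_conv_exp)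
      have "char D t = (\<integral>x. complex_of_real (W x / m * cos (t * Y x + 0)) + \<i> * complex_of_real (W x / m * cos (t * Y x + (-pi/2))) \<partial>M)"
        unfolding char_def by (subst integD) (auto simp only: *, measurable)
      also have "\<dots> = complex_of_real (\<integral>x. W x / m * cos (t * Y x + 0) \<partial>M) + \<i> * complex_of_real (\<integral>x. W x / m * cos (t * Y x + (-pi/2)) \<partial>M)"
        using intI by (subst Bochner_Integration.integral_add) (auto simp only: integrable_of_real integral_complex_of_real integral_mult_right_zero intro!: integrable_mult_right)
      also have "\<dots> = complex_of_real (\<integral>x. W' x / m * cos (t * Y' x + 0) \<partial>M') + \<i> * complex_of_real (\<integral>x. W' x / m * cos (t * Y' x + (-pi/2)) \<partial>M')"
        by (simp only: eqm)
      also have "\<dots> = (\<integral>x. complex_of_real (W' x / m * cos (t * Y' x + 0)) + \<i> * complex_of_real (W' x / m * cos (t * Y' x + (-pi/2))) \<partial>M')"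
        using intI by (subst Bochner_Integration.integral_add) (auto simp only: integrable_of_real integral_complex_of_real integral_mult_right_zero intro!: integrable_mult_right)
      also have "\<dots> = char D' t"
        unfolding char_def by (subst integD) (auto simp only: *, measurable)
      finally show "char D t = char D' t" .
    qed
    then have "D = D'" by (rule Levy_uniqueness[OF rd])
    then have "m * (\<integral>x. indicator {..y} x \<partial>D) = m * (\<integral>x. (indicator {..y} x::real) \<partial>D')" by simp
    then show ?thesis using mpos by (subst (asm) integD, simp, subst (asm) integD, simp) (simp add: field_simps)
  qed
qed

text \<open>
  One coordinate at a time, a constraint \<open>X\<^sub>j \<le> c\<close> is inserted under the integral.  To insert it, the remaining
  factor is used as the weight of the one-dimensional uniqueness lemma.  That weight must be nonnegative, so the cosine is replaced
  by \<open>1 + cos\<close>, and the contribution of the constant 1 is removed afterwards by the same argument.  The product formula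
  for cosines keeps all integrals inside the class for which the induction hypothesis speaks, which is why
  the coefficients \<open>a\<close> range over all of \<open>I\<close> and a phase \<open>b\<close> is carried along.
\<close>

lemma orthant_cosines_agree:
  fixes X :: "'i \<Rightarrow> 'a \<Rightarrow> real" and X' :: "'i \<Rightarrow> 'b \<Rightarrow> real"
  assumes M: "prob_space M" "prob_space M'" and I: "finite I" and J: "finite J" "J \<subseteq> I"
    and meas: "\<And>i. i \<in> I \<Longrightarrow> X i \<in> borel_measurable M" "\<And>i. i \<in> I \<Longrightarrow> X' i \<in> borel_measurable M'"
    and eq: "\<And>a b. (\<integral>w. cos ((\<Sum>i\<in>I. a i * X i w) + b) \<partial>M) = (\<integral>w. cos ((\<Sum>i\<in>I. a i * X' i w) + b) \<partial>M')"
  shows "(\<integral>w. (\<Prod>j\<in>J. indicator {..c} (X j w)) * cos ((\<Sum>i\<in>I. a i * X i w) + b) \<partial>M)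
       = (\<integral>w. (\<Prod>j\<in>J. indicator {..c} (X' j w)) * cos ((\<Sum>i\<in>I. a i * X' i w) + b) \<partial>M')"
  using J
proof (induction J arbitrary: a b rule: finite_induct)
  case empty
  then show ?case using eq by simp
next
  case (insert j J)
  interpret M: prob_space M by fact
  interpret M': prob_space M' by fact
  have jI: "j \<in> I" and JI: "J \<subseteq> I" using insert.prems by auto
  note [measurable] = meas[OF jI]
  have [measurable]: "X i \<in> borel_measurable M" "X' i \<in> borel_measurable M'" if "i \<in> J" for i
    using meas JI that by auto
  define S where "S a w = (\<Sum>i\<in>I. a i * X i w)" for a w
  define S' where "S' a w = (\<Sum>i\<in>I. a i * X' i w)" for a w
  define V where "V w = (\<Prod>j\<in>J. indicator {..c} (X j w) :: real)" for w
  define V' where "V' w = (\<Prod>j\<in>J. indicator {..c} (X' j w) :: real)" for w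
  have [measurable]: "S a \<in> borel_measurable M" "S' a \<in> borel_measurable M'" for a
    unfolding S_def[abs_def] S'_def[abs_def] using meas by measurable
  have [measurable]: "V \<in> borel_measurable M" "V' \<in> borel_measurable M'"
    unfolding V_def[abs_def] V'_def[abs_def] by measurable
  have V01: "0 \<le> V w" "V w \<le> 1" "0 \<le> V' w'" "V' w' \<le> 1" for w w'
    unfolding V_def V'_def by (auto intro!: prod_nonneg prod_le_1 simp: indicator_def)
  have IH: "(\<integral>w. V w * cos (S a w + b) \<partial>M) = (\<integral>w. V' w * cos (S' a w + b) \<partial>M')" for a b
    using insert.IH[OF JI] by (simp add: V_def V'_def S_def S'_def)
  define e where "e i = (if i = j then 1 else 0 :: real)" for i
  have Se: "S (\<lambda>i. a i + t * e i) w = S a w + t * X j w"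
    "S' (\<lambda>i. a i + t * e i) w' = S' a w' + t * X' j w'" for a t w w'
    using I jI unfolding S_def S'_def e_def
    by (simp_all add: distrib_right sum.distrib if_distrib[of "\<lambda>x. _ * x"] if_distrib[of "\<lambda>x. x * _"] sum.delta cong: if_cong)
  have intV: "integrable M (\<lambda>w. V w * cos (f w))" if [measurable]: "f \<in> borel_measurable M" for f
    using V01 by (intro M.integrable_const_bound[where B = 1]) (auto simp: abs_mult intro!: mult_le_one)
  have intV': "integrable M' (\<lambda>w. V' w * cos (f w))" if [measurable]: "f \<in> borel_measurable M'" for f
    using V01 by (intro M'.integrable_const_bound[where B = 1]) (auto simp: abs_mult intro!: mult_le_one)
  have one: "(\<integral>w. V w * cos (t * X j w + b) \<partial>M) = (\<integral>w. V' w * cos (t * X' j w + b) \<partial>M')" for t b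
    using IH[of "\<lambda>i. 0 + t * e i" b] unfolding Se by (simp add: S_def S'_def)
  have unweighted: "(\<integral>w. V w * indicator {..c} (X j w) \<partial>M) = (\<integral>w. V' w * indicator {..c} (X' j w) \<partial>M')"
    by (rule weighted_cdf_determined_by_cosines[OF M, where B = 1]) (auto simp: V01 one)
  have cosprod: "v * (1 + cos p) * cos q = v * cos q + (1/2) * (v * cos (p + q)) + (1/2) * (v * cos (p - q))" for v p q :: real
    by (simp add: cos_add cos_diff algebra_simps)
  have weighted: "(\<integral>w. V w * (1 + cos (S a w + b)) * indicator {..c} (X j w) \<partial>M)
        = (\<integral>w. V' w * (1 + cos (S' a w + b)) * indicator {..c} (X' j w) \<partial>M')"
  proof (rule weighted_cdf_determined_by_cosines[OF M, where B = 2])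
    have c2: "0 \<le> 1 + cos x" "1 + cos x \<le> 2" for x :: real
      using cos_ge_minus_one[of x] cos_le_one[of x] by linarith+
    show "0 \<le> V w * (1 + cos (S a w + b))" "V w * (1 + cos (S a w + b)) \<le> 2" for w
      using V01 c2 mult_mono[OF V01(2)[of w] c2(2)] by (auto intro!: mult_nonneg_nonneg)
    show "0 \<le> V' w * (1 + cos (S' a w + b))" "V' w * (1 + cos (S' a w + b)) \<le> 2" for w
      using V01 c2 mult_mono[OF V01(4)[of w] c2(2)] by (auto intro!: mult_nonneg_nonneg)
    fix t b'
    have p: "(S a w + b) + (t * X j w + b') = S (\<lambda>i. a i + t * e i) w + (b + b')"
            "(S a w + b) - (t * X j w + b') = S (\<lambda>i. a i + (-t) * e i) w + (b - b')" for w
      unfolding Se by simp_all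
    have p': "(S' a w + b) + (t * X' j w + b') = S' (\<lambda>i. a i + t * e i) w + (b + b')"
            "(S' a w + b) - (t * X' j w + b') = S' (\<lambda>i. a i + (-t) * e i) w + (b - b')" for w
      unfolding Se by simp_all
    show "(\<integral>w. V w * (1 + cos (S a w + b)) * cos (t * X j w + b') \<partial>M)
        = (\<integral>w. V' w * (1 + cos (S' a w + b)) * cos (t * X' j w + b') \<partial>M')"
      unfolding cosprod p p'
      by (simp add: intV intV' IH one)
  qed measurable
  have bi: "integrable M (\<lambda>w. V w * indicator {..c} (X j w))" "integrable M' (\<lambda>w. V' w * indicator {..c} (X' j w))"
    using V01 by (auto intro!: M.integrable_const_bound[where B = 1] M'.integrable_const_bound[where B = 1] simp: indicator_def abs_mult)
  have bi2: "integrable M (\<lambda>w. V w * indicator {..c} (X j w) * cos (S a w + b))"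
    "integrable M' (\<lambda>w. V' w * indicator {..c} (X' j w) * cos (S' a w + b))"
    using mult_le_one[OF V01(2) abs_ge_zero abs_cos_le_one] mult_le_one[OF V01(4) abs_ge_zero abs_cos_le_one] V01
    by (auto intro!: M.integrable_const_bound[where B = 1] M'.integrable_const_bound[where B = 1] simp: indicator_def abs_mult)
  have split: "v * (1 + k) * i = v * i + v * i * k" for v k i :: real by (simp add: algebra_simps)
  have "(\<integral>w. V w * indicator {..c} (X j w) * cos (S a w + b) \<partial>M) = (\<integral>w. V' w * indicator {..c} (X' j w) * cos (S' a w + b) \<partial>M')"
    using weighted unfolding split by (simp add: bi bi2 unweighted)
  then show ?case
    using insert.hyps by (simp add: V_def V'_def S_def S'_def mult_ac)
qed

text \<open>
  A Cramer-Wold principle for orthants: take all coordinates as constraints and the constant cosine.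
\<close>

lemma orthant_probability_determined_by_cosines:
  fixes X :: "'i \<Rightarrow> 'a \<Rightarrow> real" and X' :: "'i \<Rightarrow> 'b \<Rightarrow> real"
  assumes M: "prob_space M" "prob_space M'" and I: "finite I"
    and meas: "\<And>i. i \<in> I \<Longrightarrow> X i \<in> borel_measurable M" "\<And>i. i \<in> I \<Longrightarrow> X' i \<in> borel_measurable M'"
    and eq: "\<And>a b. (\<integral>w. cos ((\<Sum>i\<in>I. a i * X i w) + b) \<partial>M) = (\<integral>w. cos ((\<Sum>i\<in>I. a i * X' i w) + b) \<partial>M')"
  shows "measure M {w \<in> space M. \<forall>i\<in>I. X i w \<le> c} = (\<integral>w. (\<Prod>i\<in>I. indicator {..c} (X' i w)) \<partial>M')"
proof -
  have "measure M {w \<in> space M. \<forall>i\<in>I. X i w \<le> c} = (\<integral>w. indicator {w \<in> space M. \<forall>i\<in>I. X i w \<le> c} w \<partial>M)"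
    by (simp add: Int_def conj_ac)
  also have "\<dots> = (\<integral>w. (\<Prod>i\<in>I. indicator {..c} (X i w)) \<partial>M)"
    using I by (intro Bochner_Integration.integral_cong refl) (auto simp: indicator_def)
  also have "\<dots> = (\<integral>w. (\<Prod>i\<in>I. indicator {..c} (X' i w)) \<partial>M')"
    using orthant_cosines_agree[OF M I I order_refl meas eq, of c "\<lambda>_. 0" 0] by simp
  finally show ?thesis .
qed

section \<open>The one-factor model of equicorrelated normal variables\<close>

lemma integral_std_normal:
  fixes f :: "real \<Rightarrow> real"
  assumes "f \<in> borel_measurable borel"
  shows "(\<integral>x. f x \<partial>gauss) = (\<integral>x. \<phi> x * f x \<partial>lborel)"
  using assms by (simp add: integral_density)

text \<open>
  A normal law, possibly degenerate, is fixed by its first two moments.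
\<close>

lemma normal_rv_expectation_cos:
  assumes "prob_space M" and S: "normal_rv M S"
    and mean: "(\<integral>w. S w \<partial>M) = 0" and var: "(\<integral>w. (S w)\<^sup>2 \<partial>M) = v"
  shows "(\<integral>w. cos (S w + b) \<partial>M) = cos b * exp (- v / 2)"
proof -
  interpret prob_space M by fact
  from S consider (nondegenerate) m s where "s > 0" "distributed M lborel S (normal_density m s)"
    | (degenerate) m where "S \<in> borel_measurable M" "AE \<omega> in M. S \<omega> = m"
    unfolding normal_rv_def by blast
  then show ?thesis
  proof cases
    case nondegenerate
    have m: "m = 0" using normal_distributed_expectation[OF nondegenerate] mean by simp
    have v: "v = s\<^sup>2" using normal_distributed_variance[OF nondegenerate] mean var by simp
    have Z: "distributed M lborel (\<lambda>w. S w / s) \<phi>"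
      using nondegenerate normal_standard_normal_convert[of s S m] m by simp
    have "(\<integral>w. cos (S w + b) \<partial>M) = (\<integral>w. cos (s * (S w / s) + b) \<partial>M)"
      using nondegenerate by simp
    also have "\<dots> = (\<integral>x. cos (s * x + b) \<partial>gauss)"
      using distributed_integral[OF Z, of "\<lambda>x. cos (s * x + b)"] by (subst integral_std_normal) simp_all
    finally show ?thesis by (simp add: integral_cos_std_normal v)
  next
    case degenerate
    note [measurable] = degenerate(1)
    have "(\<integral>w. S w \<partial>M) = (\<integral>w. m \<partial>M)" using degenerate by (intro integral_cong_AE) auto
    then have m: "m = 0" using mean prob_space by simp
    have "(\<integral>w. (S w)\<^sup>2 \<partial>M) = (\<integral>w. m\<^sup>2 \<partial>M)" using degenerate by (intro integral_cong_AE) auto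
    then have v: "v = 0" using var m by simp
    have "(\<integral>w. cos (S w + b) \<partial>M) = (\<integral>w. cos b \<partial>M)" using degenerate m by (intro integral_cong_AE) auto
    then show ?thesis using v prob_space by simp
  qed
qed

text \<open>
  The variance of a linear combination with coefficients \<open>a\<^sub>i\<close> is the quadratic form of the covariance matrix
  \<open>(1 - \<rho>) * I + \<rho> * J\<close>, with \<open>J\<close> the all-ones matrix.
\<close>

lemma equicorrelated_expectation_cos:
  assumes X: "equicorrelated_std_normal M n \<rho> X"
  shows "(\<integral>w. cos ((\<Sum>i=1..n. a i * X i w) + b) \<partial>M)
       = cos b * exp (- ((1 - \<rho>) * (\<Sum>i=1..n. (a i)\<^sup>2) + \<rho> * (\<Sum>i=1..n. a i)\<^sup>2) / 2)"
proof -
  interpret prob_space M using X by (simp add: equicorrelated_std_normal_def)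
  have D: "distributed M lborel (X i) \<phi>" if "i \<in> {1..n}" for i
    using X that by (simp add: equicorrelated_std_normal_def)
  have rv: "X i \<in> borel_measurable M" if "i \<in> {1..n}" for i
    using distributed_measurable[OF D[OF that]] by simp
  have E: "(\<integral>w. X i w \<partial>M) = 0" if "i \<in> {1..n}" for i
    using standard_normal_distributed_expectation[OF D[OF that]] .
  have V: "(\<integral>w. X i w * X i w \<partial>M) = 1" if "i \<in> {1..n}" for i
    using standard_normal_distributed_variance[OF D[OF that]] E[OF that] by (simp add: power2_eq_square)
  have sq: "integrable M (\<lambda>w. (X i w)\<^sup>2)" if "i \<in> {1..n}" for i
    using distributed_integrable[OF D[OF that], of "\<lambda>x. x\<^sup>2"] integrable_std_normal_moment[of 2] by simp
  have int1: "integrable M (X i)" if "i \<in> {1..n}" for i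
    using distributed_integrable[OF D[OF that], of "\<lambda>x. x"] integrable_std_normal_moment[of 1] by simp
  have int2: "integrable M (\<lambda>w. X i w * X j w)" if ij: "i \<in> {1..n}" "j \<in> {1..n}" for i j
  proof (rule Bochner_Integration.integrable_bound)
    show "integrable M (\<lambda>w. (X i w)\<^sup>2 + (X j w)\<^sup>2)" using sq ij by simp
    have "\<bar>x * y\<bar> \<le> x\<^sup>2 + y\<^sup>2" for x y :: real
    proof -
      have "2 * \<bar>x * y\<bar> \<le> x\<^sup>2 + y\<^sup>2"
        using sum_squares_bound[of "\<bar>x\<bar>" "\<bar>y\<bar>"] by (simp add: abs_mult mult.assoc)
      then show ?thesis by (simp add: sum_nonneg)
    qed
    then show "AE w in M. norm (X i w * X j w) \<le> norm ((X i w)\<^sup>2 + (X j w)\<^sup>2)" by simp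
  qed (intro borel_measurable_times rv ij)
  have cov: "(\<integral>w. X i w * X j w \<partial>M) = (if i = j then 1 else \<rho>)" if ij: "i \<in> {1..n}" "j \<in> {1..n}" for i j
  proof (cases "i = j")
    case False
    then have "correlation M (X i) (X j) = \<rho>" using X ij by (simp add: equicorrelated_std_normal_def)
    then show ?thesis using False E V ij by (simp add: correlation_def covariance_def)
  qed (use V ij in simp)
  define S where "S w = (\<Sum>i=1..n. a i * X i w)" for w
  have "(\<integral>w. S w \<partial>M) = 0"
    unfolding S_def using int1 E by (subst Bochner_Integration.integral_sum) auto
  moreover have "(\<integral>w. (S w)\<^sup>2 \<partial>M) = (1 - \<rho>) * (\<Sum>i=1..n. (a i)\<^sup>2) + \<rho> * (\<Sum>i=1..n. a i)\<^sup>2"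
  proof -
    have "(\<integral>w. (S w)\<^sup>2 \<partial>M) = (\<integral>w. (\<Sum>i=1..n. \<Sum>j=1..n. (a i * a j) * (X i w * X j w)) \<partial>M)"
      unfolding S_def power2_eq_square sum_product by (simp add: mult_ac)
    also have "\<dots> = (\<Sum>i=1..n. \<Sum>j=1..n. (a i * a j) * (\<integral>w. X i w * X j w \<partial>M))"
    proof -
      have inner: "integrable M (\<lambda>w. \<Sum>j=1..n. (a i * a j) * (X i w * X j w))" if "i \<in> {1..n}" for i
        by (intro Bochner_Integration.integrable_sum integrable_mult_right int2 that)
      show ?thesis
        by (subst Bochner_Integration.integral_sum[OF inner], assumption, intro sum.cong refl,
            subst Bochner_Integration.integral_sum, intro integrable_mult_right int2) simp_all
    qed
    also have "\<dots> = (\<Sum>i=1..n. \<Sum>j=1..n. (a i * a j) * (if i = j then 1 else \<rho>))"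
      using cov by (intro sum.cong refl) simp
    also have "\<dots> = (\<Sum>i=1..n. \<Sum>j=1..n. \<rho> * (a i * a j) + (if i = j then (1 - \<rho>) * (a i * a j) else 0))"
      by (intro sum.cong refl) (simp add: algebra_simps)
    also have "\<dots> = (\<Sum>i=1..n. \<Sum>j=1..n. \<rho> * (a i * a j)) + (\<Sum>i=1..n. (1 - \<rho>) * (a i * a i))"
      by (simp add: sum.distrib)
    also have "\<dots> = (1 - \<rho>) * (\<Sum>i=1..n. (a i)\<^sup>2) + \<rho> * (\<Sum>i=1..n. a i)\<^sup>2"
      unfolding power2_eq_square sum_product by (simp add: sum_distrib_left)
    finally show ?thesis .
  qed
  moreover have "normal_rv M S"
    using X unfolding equicorrelated_std_normal_def jointly_normal_def S_def[abs_def] by simp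
  ultimately show ?thesis
    using normal_rv_expectation_cos[OF prob_space_axioms, of S _ b] unfolding S_def by blast
qed

lemma iid_expectation_cos:
  fixes a :: "'i \<Rightarrow> real"
  assumes "finite I"
  shows "(\<integral>w. cos ((\<Sum>i\<in>I. a i * w i) + b) \<partial>Pi\<^sub>M I (\<lambda>_. gauss)) = cos b * exp (- (\<Sum>i\<in>I. (a i)\<^sup>2) / 2)"
  using assms
proof (induction I arbitrary: b rule: finite_induct)
  interpret N: real_distribution gauss by (rule real_dist_normal_dist)
  interpret P: product_prob_space "\<lambda>_::'i. gauss" UNIV ..
  {
    case empty
    interpret E: prob_space "Pi\<^sub>M {} (\<lambda>_::'i. gauss)" by (intro prob_space_PiM N.prob_space_axioms)
    show ?case using E.prob_space by simp
  next
    case (insert i I)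
    interpret J: prob_space "Pi\<^sub>M (insert i I) (\<lambda>_::'i. gauss)" by (intro prob_space_PiM N.prob_space_axioms)
    have "(\<integral>w. cos ((\<Sum>j\<in>insert i I. a j * w j) + b) \<partial>Pi\<^sub>M (insert i I) (\<lambda>_. gauss))
       = (\<integral>w. (\<integral>y. cos ((\<Sum>j\<in>insert i I. a j * (w(i := y)) j) + b) \<partial>gauss) \<partial>Pi\<^sub>M I (\<lambda>_. gauss))"
      using insert.hyps by (intro P.product_integral_insert J.integrable_const_bound[where B = 1]) auto
    also have "\<dots> = (\<integral>w. (\<integral>y. cos (a i * y + ((\<Sum>j\<in>I. a j * w j) + b)) \<partial>gauss) \<partial>Pi\<^sub>M I (\<lambda>_. gauss))"
    proof -
      have "(\<Sum>j\<in>insert i I. a j * (w(i := y)) j) + b = a i * y + ((\<Sum>j\<in>I. a j * w j) + b)" for w y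
        using insert.hyps by (auto intro!: sum.cong)
      then show ?thesis by (simp only:)
    qed
    also have "\<dots> = cos b * exp (- (\<Sum>j\<in>insert i I. (a j)\<^sup>2) / 2)"
      unfolding integral_cos_std_normal using insert by (simp add: add_divide_distrib exp_add[symmetric])
    finally show ?case .
  }
qed

text \<open>
  Coordinate 0 of the product space is the common factor, coordinates 1 to \<open>n\<close> are the individual noises.  The linear
  combinations in this model have the variances required above, so the orthant probability is that of the model;
  integrating the noises first leaves \<open>n\<close> independent one-dimensional constraints for each value of the factor.
\<close>

lemma equicorrelated_orthant_probability:
  assumes X: "equicorrelated_std_normal M n \<rho> X" and \<rho>: "0 \<le> \<rho>" "\<rho> < 1"
  shows "measure M {w \<in> space M. \<forall>i\<in>{1..n}. X i w \<le> c}
       = (\<integral>z. \<Phi> ((c - sqrt \<rho> * z) / sqrt (1 - \<rho>)) ^ n \<partial>gauss)"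
proof -
  interpret N: real_distribution gauss by (rule real_dist_normal_dist)
  interpret P: product_prob_space "\<lambda>_::nat. gauss" UNIV ..
  interpret J: prob_space "Pi\<^sub>M {1..n} (\<lambda>_::nat. gauss)" by (intro prob_space_PiM N.prob_space_axioms)
  interpret J0: prob_space "Pi\<^sub>M (insert 0 {1..n}) (\<lambda>_::nat. gauss)" by (intro prob_space_PiM N.prob_space_axioms)
  interpret PS: pair_prob_space gauss "Pi\<^sub>M {1..n} (\<lambda>_::nat. gauss)" ..
  have M: "prob_space M" using X by (simp add: equicorrelated_std_normal_def)
  define P where "P = Pi\<^sub>M (insert 0 {1..n}) (\<lambda>_::nat. gauss)"
  define Y where "Y i w = sqrt \<rho> * w 0 + sqrt (1 - \<rho>) * w i" for i :: nat and w :: "nat \<Rightarrow> real"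
  have cosY: "(\<integral>w. cos ((\<Sum>i=1..n. a i * Y i w) + b) \<partial>P)
      = cos b * exp (- ((1 - \<rho>) * (\<Sum>i=1..n. (a i)\<^sup>2) + \<rho> * (\<Sum>i=1..n. a i)\<^sup>2) / 2)" for a b
  proof -
    \<comment> \<open>the coefficients of the independent coordinates in \<open>\<Sum>i. a i * Y i\<close>\<close>
    define a' where "a' i = (if i = 0 then sqrt \<rho> * (\<Sum>i=1..n. a i) else sqrt (1 - \<rho>) * a i)" for i
    have "(\<Sum>i=1..n. a i * Y i w) = (\<Sum>i\<in>insert 0 {1..n}. a' i * w i)" for w
    proof -
      have "(\<Sum>i\<in>insert 0 {1..n}. a' i * w i) = sqrt \<rho> * (\<Sum>i=1..n. a i) * w 0 + (\<Sum>i=1..n. sqrt (1 - \<rho>) * a i * w i)"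
        by (simp add: a'_def)
      then show ?thesis
        by (simp add: Y_def algebra_simps sum.distrib sum_distrib_left sum_distrib_right)
    qed
    then have "(\<integral>w. cos ((\<Sum>i=1..n. a i * Y i w) + b) \<partial>P) = cos b * exp (- (\<Sum>i\<in>insert 0 {1..n}. (a' i)\<^sup>2) / 2)"
      unfolding P_def by (simp only: iid_expectation_cos finite_insert finite_atLeastAtMost)
    also have "(\<Sum>i\<in>insert 0 {1..n}. (a' i)\<^sup>2) = (1 - \<rho>) * (\<Sum>i=1..n. (a i)\<^sup>2) + \<rho> * (\<Sum>i=1..n. a i)\<^sup>2"
      using \<rho> by (simp add: a'_def power_mult_distrib flip: sum_distrib_left)
    finally show ?thesis .
  qed
  have measX: "X i \<in> borel_measurable M" if "i \<in> {1..n}" for i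
  proof -
    have "distributed M lborel (X i) \<phi>" using X that by (simp add: equicorrelated_std_normal_def)
    from distributed_measurable[OF this] show ?thesis by simp
  qed
  have measY: "Y i \<in> borel_measurable P" if "i \<in> {1..n}" for i
  proof -
    have "(\<lambda>w. w k) \<in> borel_measurable P" if "k \<in> insert 0 {1..n}" for k
      using measurable_component_singleton[OF that, of "\<lambda>_. gauss"] unfolding P_def by simp
    with that show ?thesis unfolding Y_def[abs_def] by simp
  qed
  have "measure M {w \<in> space M. \<forall>i\<in>{1..n}. X i w \<le> c} = (\<integral>w. (\<Prod>i\<in>{1..n}. indicator {..c} (Y i w)) \<partial>P)"
  proof (rule orthant_probability_determined_by_cosines[OF M _ _ measX])
    show "prob_space P" unfolding P_def by (rule J0.prob_space_axioms)
    show "Y i \<in> borel_measurable P" if "i \<in> {1..n}" for i by (rule measY[OF that])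
    show "(\<integral>w. cos ((\<Sum>i=1..n. a i * X i w) + b) \<partial>M) = (\<integral>w. cos ((\<Sum>i=1..n. a i * Y i w) + b) \<partial>P)" for a b
      by (simp only: equicorrelated_expectation_cos[OF X] cosY)
  qed auto
  also have "\<dots> = (\<integral>w. (\<integral>z. (\<Prod>i\<in>{1..n}. indicator {..c} (Y i (w(0 := z)))) \<partial>gauss) \<partial>Pi\<^sub>M {1..n} (\<lambda>_. gauss))"
    unfolding P_def
  proof (intro P.product_integral_insert J0.integrable_const_bound[where B = 1])
    show "AE w in Pi\<^sub>M (insert 0 {1..n}) (\<lambda>_. gauss). norm (\<Prod>i\<in>{1..n}. indicator {..c} (Y i w) :: real) \<le> 1"
      by (auto intro!: AE_I2 prod_le_1 simp: abs_prod indicator_def)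
    show "(\<lambda>w. \<Prod>i\<in>{1..n}. indicator {..c} (Y i w) :: real) \<in> borel_measurable (Pi\<^sub>M (insert 0 {1..n}) (\<lambda>_. gauss))"
      using measY unfolding P_def by measurable
  qed auto
  also have "\<dots> = (\<integral>w. (\<integral>z. (\<Prod>i\<in>{1..n}. indicator {..c} (sqrt \<rho> * z + sqrt (1 - \<rho>) * w i)) \<partial>gauss) \<partial>Pi\<^sub>M {1..n} (\<lambda>_. gauss))"
    by (simp add: Y_def)
  also have "\<dots> = (\<integral>z. (\<integral>w. (\<Prod>i\<in>{1..n}. indicator {..c} (sqrt \<rho> * z + sqrt (1 - \<rho>) * w i)) \<partial>Pi\<^sub>M {1..n} (\<lambda>_. gauss)) \<partial>gauss)"
  proof (rule PS.Fubini_integral)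
    show "integrable (gauss \<Otimes>\<^sub>M Pi\<^sub>M {1..n} (\<lambda>_. gauss)) (\<lambda>(z, w). \<Prod>i\<in>{1..n}. indicator {..c} (sqrt \<rho> * z + sqrt (1 - \<rho>) * w i) :: real)"
      by (rule PS.P.integrable_const_bound[where B = 1])
         (auto intro!: AE_I2 prod_le_1 simp: abs_prod indicator_def)
  qed
  also have "\<dots> = (\<integral>z. (\<Prod>i\<in>{1..n}. (\<integral>y. indicator {..c} (sqrt \<rho> * z + sqrt (1 - \<rho>) * y) \<partial>gauss)) \<partial>gauss)"
    by (intro Bochner_Integration.integral_cong refl P.product_integral_prod N.integrable_const_bound[where B = 1])
       (auto simp: indicator_def)
  also have "\<dots> = (\<integral>z. \<Phi> ((c - sqrt \<rho> * z) / sqrt (1 - \<rho>)) ^ n \<partial>gauss)"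
  proof -
    have "(indicator {..c} (sqrt \<rho> * z + sqrt (1 - \<rho>) * y) :: real) = indicator {..(c - sqrt \<rho> * z) / sqrt (1 - \<rho>)} y" for z y
      using \<rho> by (auto simp: indicator_def field_simps)
    then show ?thesis by (simp add: cdf_def2)
  qed
  finally show ?thesis .
qed

section \<open>Differentiating Gaussian mixtures in the correlation\<close>

text \<open>
  Difference quotients are bounded by the dominating function through the mean value inequality, so dominated
  convergence along any sequence tending to \<open>x\<close> gives the limit.
\<close>

lemma DERIV_integral_dominated:
  fixes f f' :: "real \<Rightarrow> 'a \<Rightarrow> real"
  assumes x: "x \<in> {a<..<b}"
    and int: "\<And>y. y \<in> {a<..<b} \<Longrightarrow> integrable M (f y)"
    and der: "\<And>y u. y \<in> {a<..<b} \<Longrightarrow> ((\<lambda>y. f y u) has_real_derivative f' y u) (at y)"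
    and bound: "\<And>y u. y \<in> {a<..<b} \<Longrightarrow> \<bar>f' y u\<bar> \<le> B u"
    and B: "integrable M B"
    and meas: "f' x \<in> borel_measurable M"
  shows "((\<lambda>y. \<integral>u. f y u \<partial>M) has_real_derivative (\<integral>u. f' x u \<partial>M)) (at x)"
  unfolding has_field_derivative_iff
proof (subst tendsto_at_iff_sequentially, intro allI impI)
  fix X :: "nat \<Rightarrow> real"
  assume X: "\<forall>i. X i \<in> UNIV - {x}" "X \<longlonglongrightarrow> x"
  have "\<forall>\<^sub>F i in sequentially. X i \<in> {a<..<b}"
    using X(2) x by (intro topological_tendstoD) auto
  then obtain N where N: "\<And>i. i \<ge> N \<Longrightarrow> X i \<in> {a<..<b}" by (auto simp: eventually_sequentially)
  define D where "D i u = (f (X (i + N)) u - f x u) / (X (i + N) - x)" for i u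
  have DX: "(\<integral>u. D i u \<partial>M) = ((\<integral>u. f (X (i + N)) u \<partial>M) - (\<integral>u. f x u \<partial>M)) / (X (i + N) - x)" for i
    unfolding D_def using int[OF N[of "i + N"]] int[OF x] by simp
  have "(\<lambda>i. \<integral>u. D i u \<partial>M) \<longlonglongrightarrow> (\<integral>u. f' x u \<partial>M)"
  proof (rule integral_dominated_convergence[where w = B])
    show "D i \<in> borel_measurable M" for i
      unfolding D_def[abs_def] using int[OF N[of "i + N"]] int[OF x] by (simp add: borel_measurable_integrable)
    show "AE u in M. (\<lambda>i. D i u) \<longlonglongrightarrow> f' x u"
    proof (intro AE_I2)
      fix u
      have "((\<lambda>y. (f y u - f x u) / (y - x)) \<longlongrightarrow> f' x u) (at x)"
        using der[OF x] by (simp add: has_field_derivative_iff)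
      then show "(\<lambda>i. D i u) \<longlonglongrightarrow> f' x u"
        unfolding D_def tendsto_at_iff_sequentially
        using X LIMSEQ_ignore_initial_segment[OF X(2), of N]
        by (auto simp: comp_def dest!: spec[of _ "\<lambda>i. X (i + N)"])
    qed
    show "AE u in M. norm (D i u) \<le> B u" for i
    proof (intro AE_I2)
      fix u
      have *: "\<bar>f y u - f x u\<bar> \<le> B u * \<bar>y - x\<bar>" if y: "y \<in> {a<..<b}" for y
      proof -
        have "norm (f y u - f x u) \<le> B u * norm (y - x)"
        proof (rule field_differentiable_bound[where S = "{a<..<b}" and f' = "\<lambda>y. f' y u"])
          show "((\<lambda>y. f y u) has_field_derivative f' z u) (at z within {a<..<b})" if "z \<in> {a<..<b}" for z
            using der[OF that] by (rule has_field_derivative_at_within)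
        qed (use bound x y in auto)
        then show ?thesis by simp
      qed
      have "X (i + N) - x \<noteq> 0" using X(1) by auto
      then show "norm (D i u) \<le> B u"
        using *[OF N[of "i + N"]] by (simp add: D_def divide_le_eq)
    qed
  qed (use B meas in auto)
  then have "(\<lambda>i. ((\<integral>u. f (X (i + N)) u \<partial>M) - (\<integral>u. f x u \<partial>M)) / (X (i + N) - x)) \<longlonglongrightarrow> (\<integral>u. f' x u \<partial>M)"
    by (simp add: DX)
  then show "((\<lambda>y. ((\<integral>u. f y u \<partial>M) - (\<integral>u. f x u \<partial>M)) / (y - x)) \<circ> X) \<longlonglongrightarrow> (\<integral>u. f' x u \<partial>M)"
    unfolding comp_def by (rule LIMSEQ_offset)
qed

text \<open>
  The value of the common factor for which the noise threshold \<open>(c - sqrt \<rho> * z) / sqrt (1 - \<rho>)\<close> equals \<open>u\<close>.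
\<close>

definition mixing_point :: "real \<Rightarrow> real \<Rightarrow> real \<Rightarrow> real" where
  "mixing_point c \<rho> u = (c - sqrt (1 - \<rho>) * u) / sqrt \<rho>"

text \<open>
  The density at \<open>u\<close> of the random threshold \<open>(c - sqrt \<rho> * Z) / sqrt (1 - \<rho>)\<close>, a normal law with mean
  \<open>c / sqrt (1 - \<rho>)\<close> and variance \<open>\<rho> / (1 - \<rho>)\<close>.
\<close>

definition mixing_density :: "real \<Rightarrow> real \<Rightarrow> real \<Rightarrow> real" where
  "mixing_density c \<rho> u = sqrt ((1 - \<rho>) / \<rho>) * \<phi> (mixing_point c \<rho> u)"

text \<open>
  The first and second \<open>\<rho>\<close>-derivatives of the mixing density are the density times these polynomials, evaluated at
  \<open>h = mixing_point c \<rho> u\<close> and \<open>C = c * sqrt \<rho>\<close>, divided by \<open>2 * \<rho> * (1 - \<rho>)\<close> and by its square.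
\<close>

definition score_poly :: "real \<Rightarrow> real \<Rightarrow> real" where
  "score_poly C h = h\<^sup>2 - C * h - 1"

definition curvature_poly :: "real \<Rightarrow> real \<Rightarrow> real \<Rightarrow> real" where
  "curvature_poly \<rho> C h = (score_poly C h)\<^sup>2 - (2 * h - C) * (h - C)
      - 2 * (1 - 2 * \<rho>) * score_poly C h - (1 - \<rho>) * C * h"

lemma DERIV_mixing_point:
  assumes \<rho>: "0 < \<rho>" "\<rho> < 1"
  shows "((\<lambda>\<rho>. mixing_point c \<rho> u) has_real_derivative
      (c * sqrt \<rho> - mixing_point c \<rho> u) / (2 * \<rho> * (1 - \<rho>))) (at \<rho>)"
proof -
  define s q where "s = sqrt (1 - \<rho>)" and "q = sqrt \<rho>"
  have pos: "0 < s" "0 < q" using \<rho> by (auto simp: s_def q_def)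
  have sq: "\<rho> = q\<^sup>2" "1 - \<rho> = s\<^sup>2" "s\<^sup>2 = 1 - q\<^sup>2" using \<rho> by (auto simp: s_def q_def)
  have Ds: "((\<lambda>\<rho>. sqrt (1 - \<rho>)) has_real_derivative - (inverse s / 2)) (at \<rho>)"
    and Dq: "(sqrt has_real_derivative inverse q / 2) (at \<rho>)"
    unfolding s_def q_def using \<rho> by (auto intro!: derivative_eq_intros)
  have "((\<lambda>\<rho>. mixing_point c \<rho> u) has_real_derivative
      ((0 - (- (inverse s / 2)) * u) * q - (c - s * u) * (inverse q / 2)) / (q * q)) (at \<rho>)"
    unfolding mixing_point_def s_def[symmetric] q_def[symmetric]
  proof -
    have "((\<lambda>\<rho>. (c - sqrt (1 - \<rho>) * u) / sqrt \<rho>) has_real_derivative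
      ((0 - (- (inverse s / 2)) * u) * sqrt \<rho> - (c - sqrt (1 - \<rho>) * u) * (inverse q / 2)) / (sqrt \<rho> * sqrt \<rho>)) (at \<rho>)"
      by (intro DERIV_divide DERIV_diff DERIV_const DERIV_cmult_right Ds Dq) (use \<rho> in simp)
    then show "((\<lambda>\<rho>. (c - sqrt (1 - \<rho>) * u) / sqrt \<rho>) has_real_derivative
      ((0 - (- (inverse s / 2)) * u) * q - (c - s * u) * (inverse q / 2)) / (q * q)) (at \<rho>)"
      by (simp only: s_def q_def)
  qed
  also have "((0 - (- (inverse s / 2)) * u) * q - (c - s * u) * (inverse q / 2)) / (q * q)
      = (c * q - (c - s * u) / q) / (2 * q\<^sup>2 * s\<^sup>2)"
  proof -
    have "((0 - (- (inverse s / 2)) * u) * q - (c - s * u) * (inverse q / 2)) * (2 * s\<^sup>2)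
        = s * u * q - ((c - s * u) / q) * s\<^sup>2"
      using pos by (simp add: field_simps power2_eq_square)
    also have "\<dots> = c * q - (c - s * u) / q"
      unfolding sq(3) using pos by (simp add: right_diff_distrib power2_eq_square) (simp add: algebra_simps)
    finally show ?thesis
      using pos by (simp add: divide_simps power2_eq_square)
  qed
  finally show ?thesis
    by (simp add: mixing_point_def sq(1,2)[symmetric] flip: s_def q_def) 
qed

lemma DERIV_std_normal_density: "(\<phi> has_real_derivative - x * \<phi> x) (at x)"
proof -
  have "((\<lambda>x. k * exp (- x\<^sup>2 / 2)) has_real_derivative - x * (k * exp (- x\<^sup>2 / 2))) (at x)" for k :: real
    by (auto intro!: derivative_eq_intros)
  then show ?thesis unfolding std_normal_density_def[abs_def] .
qed

lemma DERIV_mixing_density: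
  assumes \<rho>: "0 < \<rho>" "\<rho> < 1"
  shows "((\<lambda>\<rho>. mixing_density c \<rho> u) has_real_derivative
     mixing_density c \<rho> u * (score_poly (c * sqrt \<rho>) (mixing_point c \<rho> u) / (2 * \<rho> * (1 - \<rho>)))) (at \<rho>)"
proof -
  let ?h = "mixing_point c \<rho> u" and ?R = "1 / (2 * \<rho> * (1 - \<rho>))"
  have a: "((\<lambda>\<rho>. sqrt ((1 - \<rho>) / \<rho>)) has_real_derivative - sqrt ((1 - \<rho>) / \<rho>) * ?R) (at \<rho>)"
  proof -
    define A where "A = sqrt ((1 - \<rho>) / \<rho>)"
    have A: "A > 0" "A\<^sup>2 = (1 - \<rho>) / \<rho>" using \<rho> by (auto simp: A_def)
    have "((\<lambda>\<rho>. sqrt ((1 - \<rho>) / \<rho>)) has_real_derivative (inverse A / 2) * (((0 - 1) * \<rho> - (1 - \<rho>) * 1) / (\<rho> * \<rho>))) (at \<rho>)"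
    proof -
      have "((\<lambda>\<rho>. (1 - \<rho>) / \<rho>) has_real_derivative ((0 - 1) * \<rho> - (1 - \<rho>) * 1) / (\<rho> * \<rho>)) (at \<rho>)"
        using \<rho> by (auto intro!: derivative_eq_intros)
      moreover have "0 < (1 - \<rho>) / \<rho>" using \<rho> by simp
      ultimately show ?thesis unfolding A_def by (intro DERIV_chain2[OF DERIV_real_sqrt])
    qed
    also have "(inverse A / 2) * (((0 - 1) * \<rho> - (1 - \<rho>) * 1) / (\<rho> * \<rho>)) = - A * ?R"
    proof -
      have "inverse A = A * (\<rho> / (1 - \<rho>))"
        using A \<rho> by (simp add: field_simps power2_eq_square)
      then show ?thesis using \<rho> by (simp only:) (simp add: divide_simps)
    qed
    finally show ?thesis by (simp add: A_def)
  qed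
  have "((\<lambda>\<rho>. mixing_density c \<rho> u) has_real_derivative
     (- sqrt ((1 - \<rho>) / \<rho>) * ?R) * \<phi> ?h + sqrt ((1 - \<rho>) / \<rho>) * ((- ?h * \<phi> ?h) * ((c * sqrt \<rho> - ?h) / (2 * \<rho> * (1 - \<rho>))))) (at \<rho>)"
    unfolding mixing_density_def[abs_def]
    using DERIV_mult[OF a DERIV_chain2[OF DERIV_std_normal_density DERIV_mixing_point[OF \<rho>, of c u]]]
    by (simp add: mult_ac add_ac)
  then show ?thesis
  proof (rule DERIV_cong)
    have "- a * (1 / D) * p + a * ((- h * p) * ((C - h) / D)) = a * p * ((h\<^sup>2 - C * h - 1) / D)" for a D p h C :: real
      by (simp add: divide_inverse power2_eq_square algebra_simps)
    then show "(- sqrt ((1 - \<rho>) / \<rho>) * ?R) * \<phi> ?h + sqrt ((1 - \<rho>) / \<rho>) * ((- ?h * \<phi> ?h) * ((c * sqrt \<rho> - ?h) / (2 * \<rho> * (1 - \<rho>))))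
       = mixing_density c \<rho> u * (score_poly (c * sqrt \<rho>) ?h / (2 * \<rho> * (1 - \<rho>)))"
      unfolding mixing_density_def score_poly_def .
  qed
qed

lemma DERIV2_mixing_density:
  assumes \<rho>: "0 < \<rho>" "\<rho> < 1"
  shows "((\<lambda>\<rho>. mixing_density c \<rho> u * (score_poly (c * sqrt \<rho>) (mixing_point c \<rho> u) / (2 * \<rho> * (1 - \<rho>)))) has_real_derivative
     mixing_density c \<rho> u * (curvature_poly \<rho> (c * sqrt \<rho>) (mixing_point c \<rho> u) / (2 * \<rho> * (1 - \<rho>))\<^sup>2)) (at \<rho>)"
proof -
  define q where "q = sqrt \<rho>"
  define h where "h = mixing_point c \<rho> u"
  define E where "E = 2 * \<rho> * (1 - \<rho>)"
  define h' where "h' = (c * q - h) / E"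
  define k where "k = mixing_density c \<rho> u"
  have q: "q > 0" "\<rho> = q\<^sup>2" using \<rho> by (auto simp: q_def)
  have E: "E > 0" using \<rho> by (simp add: E_def)
  have Dh: "((\<lambda>\<rho>. mixing_point c \<rho> u) has_real_derivative h') (at \<rho>)"
    using DERIV_mixing_point[OF \<rho>, of c u] by (simp add: h'_def h_def q_def E_def)
  have DC: "((\<lambda>\<rho>. c * sqrt \<rho>) has_real_derivative c / (2 * q)) (at \<rho>)"
    using \<rho> by (auto intro!: derivative_eq_intros simp: q_def field_simps)
  have Ds: "((\<lambda>\<rho>. score_poly (c * sqrt \<rho>) (mixing_point c \<rho> u)) has_real_derivative
      2 * h * h' - (c / (2 * q) * h + c * q * h')) (at \<rho>)"
    unfolding score_poly_def
    by (rule derivative_eq_intros Dh DC refl)+ (simp add: h_def q_def)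
  have DE: "((\<lambda>\<rho>. 2 * \<rho> * (1 - \<rho>)) has_real_derivative 2 * (1 - 2 * \<rho>)) (at \<rho>)"
    by (auto intro!: derivative_eq_intros)
  have Ds2: "((\<lambda>\<rho>. score_poly (c * sqrt \<rho>) (mixing_point c \<rho> u) / (2 * \<rho> * (1 - \<rho>))) has_real_derivative
     ((2 * h * h' - (c / (2 * q) * h + c * q * h')) * E - score_poly (c * q) h * (2 * (1 - 2 * \<rho>))) / (E * E)) (at \<rho>)"
    using DERIV_divide[OF Ds DE] \<rho> by (simp add: h_def q_def E_def)
  have "((\<lambda>\<rho>. mixing_density c \<rho> u * (score_poly (c * sqrt \<rho>) (mixing_point c \<rho> u) / (2 * \<rho> * (1 - \<rho>)))) has_real_derivative
     (k * (score_poly (c * q) h / E)) * (score_poly (c * q) h / E) +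
     k * (((2 * h * h' - (c / (2 * q) * h + c * q * h')) * E - score_poly (c * q) h * (2 * (1 - 2 * \<rho>))) / (E * E))) (at \<rho>)"
    using DERIV_mult[OF DERIV_mixing_density[OF \<rho>, of c u] Ds2]
    by (simp add: k_def h_def q_def E_def mult_ac add_ac)
  also have "(k * (score_poly (c * q) h / E)) * (score_poly (c * q) h / E) +
     k * (((2 * h * h' - (c / (2 * q) * h + c * q * h')) * E - score_poly (c * q) h * (2 * (1 - 2 * \<rho>))) / (E * E))
     = k * (curvature_poly \<rho> (c * q) h / E\<^sup>2)"
  proof -
    have h'E: "h' * E = c * q - h" using E by (simp add: h'_def)
    have cq: "c / (2 * q) * E = (1 - \<rho>) * (c * q)"
      unfolding E_def q(2) using q(1) by (simp add: power2_eq_square)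
    have "(2 * h * h' - (c / (2 * q) * h + c * q * h')) * E
        = (2 * h - c * q) * (h' * E) - (c / (2 * q) * E) * h"
      by (simp add: algebra_simps)
    also have "\<dots> = - (2 * h - c * q) * (h - c * q) - (1 - \<rho>) * (c * q) * h"
      unfolding h'E cq by (simp add: algebra_simps)
    finally have *: "(2 * h * h' - (c / (2 * q) * h + c * q * h')) * E
        = - (2 * h - c * q) * (h - c * q) - (1 - \<rho>) * (c * q) * h" .
    show ?thesis unfolding * curvature_poly_def
      by (simp add: divide_inverse power2_eq_square algebra_simps)
  qed
  finally show ?thesis by (simp add: k_def h_def q_def E_def)
qed



lemma mixing_density_nonneg: "0 < \<rho> \<Longrightarrow> \<rho> < 1 \<Longrightarrow> 0 \<le> mixing_density c \<rho> u"
  by (simp add: mixing_density_def)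

lemma measurable_mixing [measurable]:
  "(\<lambda>u. mixing_point c \<rho> u) \<in> borel_measurable borel"
  "(\<lambda>u. mixing_density c \<rho> u) \<in> borel_measurable borel"
  "score_poly C \<in> borel_measurable borel"
  "curvature_poly \<rho> C \<in> borel_measurable borel"
  unfolding mixing_density_def[abs_def] mixing_point_def[abs_def] score_poly_def[abs_def] curvature_poly_def[abs_def]
  by measurable

text \<open>
  Passing from the factor \<open>z\<close> to the threshold \<open>u\<close> moves all dependence on \<open>\<rho>\<close> from the integrand, which is merely
  monotone in the threshold, into a smooth density.
\<close>

lemma integral_change_to_mixing_density:
  fixes f :: "real \<Rightarrow> real \<Rightarrow> real"
  assumes \<rho>: "0 < \<rho>" "\<rho> < 1"
  shows "(\<integral>z. \<phi> z * f z ((c - sqrt \<rho> * z) / sqrt (1 - \<rho>)) \<partial>lborel)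
       = (\<integral>u. mixing_density c \<rho> u * f (mixing_point c \<rho> u) u \<partial>lborel)"
proof -
  define s q where "s = sqrt (1 - \<rho>)" and "q = sqrt \<rho>"
  have pos: "0 < s" "0 < q" using \<rho> by (auto simp: s_def q_def)
  have h: "c / q + (- s / q) * u = mixing_point c \<rho> u" for u
    by (simp add: mixing_point_def s_def q_def diff_divide_distrib)
  have u_back: "(c - q * mixing_point c \<rho> u) / s = u" for u
    using pos by (simp add: mixing_point_def flip: s_def q_def)
  have "(\<integral>z. \<phi> z * f z ((c - q * z) / s) \<partial>lborel)
     = \<bar>- s / q\<bar> *\<^sub>R (\<integral>u. \<phi> (c / q + (- s / q) * u) * f (c / q + (- s / q) * u) ((c - q * (c / q + (- s / q) * u)) / s) \<partial>lborel)"
    using pos by (intro lborel_integral_real_affine) simp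
  also have "\<dots> = (\<integral>u. (s / q) * (\<phi> (mixing_point c \<rho> u) * f (mixing_point c \<rho> u) u) \<partial>lborel)"
    unfolding h u_back using pos by simp
  also have "\<dots> = (\<integral>u. mixing_density c \<rho> u * f (mixing_point c \<rho> u) u \<partial>lborel)"
    by (simp add: mixing_density_def real_sqrt_divide s_def q_def mult.assoc)
  finally show ?thesis by (simp add: s_def q_def)
qed

lemma score_poly_bound: "\<bar>C\<bar> \<le> A \<Longrightarrow> \<bar>score_poly C h\<bar> \<le> (1 + A) * (1 + h\<^sup>2)"
proof -
  assume C: "\<bar>C\<bar> \<le> A"
  have h: "\<bar>h\<bar> \<le> 1 + h\<^sup>2"
  proof -
    have "0 \<le> (\<bar>h\<bar> - 1)\<^sup>2" by simp
    then show ?thesis by (simp add: power2_diff)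
  qed
  have "\<bar>C * h\<bar> \<le> A * (1 + h\<^sup>2)"
    unfolding abs_mult using C h by (intro mult_mono) auto
  from abs_le_D1[OF this] abs_le_D2[OF this] have "h\<^sup>2 - C * h - 1 \<le> 1 + h\<^sup>2 + A * (1 + h\<^sup>2)"
    "- (h\<^sup>2 - C * h - 1) \<le> 1 + h\<^sup>2 + A * (1 + h\<^sup>2)"
    using zero_le_power2[of h] by linarith+
  then show ?thesis unfolding score_poly_def distrib_right[of 1 A] by (simp only: mult_1 abs_leI)
qed

lemma curvature_poly_bound:
  assumes C: "\<bar>C\<bar> \<le> A" and \<rho>: "0 < \<rho>" "\<rho> < 1"
  shows "\<bar>curvature_poly \<rho> C h\<bar> \<le> 5 * (1 + A)\<^sup>2 * (1 + h\<^sup>2)\<^sup>2"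
proof -
  define y where "y = 1 + h\<^sup>2"
  have y: "1 \<le> y" by (simp add: y_def)
  have A: "0 \<le> A" using C by simp
  have s: "\<bar>score_poly C h\<bar> \<le> (1 + A) * y" using score_poly_bound[OF C] by (simp add: y_def)
  have h: "\<bar>h\<bar> \<le> y"
  proof -
    have "0 \<le> (\<bar>h\<bar> - 1)\<^sup>2" by simp
    then show ?thesis by (simp add: power2_diff y_def)
  qed
  have Ch: "\<bar>C * h\<bar> \<le> A * y"
    unfolding abs_mult using C h by (intro mult_mono) auto
  have 1: "\<bar>(score_poly C h)\<^sup>2\<bar> \<le> (1 + A)\<^sup>2 * y\<^sup>2"
    using power_mono[OF s, of 2] by (simp add: power_mult_distrib)
  have C2: "C\<^sup>2 \<le> A\<^sup>2" using power_mono[OF C, of 2] by simp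
  have 2: "\<bar>(2 * h - C) * (h - C)\<bar> \<le> (2 + 3 * A + A\<^sup>2) * y"
  proof -
    have eq: "(2 * h - C) * (h - C) = 2 * h\<^sup>2 - 3 * (C * h) + C\<^sup>2"
      by (simp add: algebra_simps power2_eq_square)
    have "A\<^sup>2 \<le> A\<^sup>2 * y" using mult_left_mono[OF y, of "A\<^sup>2"] by simp
    then have "\<bar>2 * h\<^sup>2 - 3 * (C * h) + C\<^sup>2\<bar> \<le> 2 * y + 3 * (A * y) + A\<^sup>2 * y"
      using Ch C2 by (simp add: abs_le_iff y_def) (smt (verit) zero_le_power2)
    then show ?thesis unfolding eq by (simp add: algebra_simps)
  qed
  have 3: "\<bar>2 * (1 - 2 * \<rho>) * score_poly C h\<bar> \<le> 2 * ((1 + A) * y)"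
    unfolding abs_mult using \<rho> s by (intro mult_mono) auto
  have 4: "\<bar>(1 - \<rho>) * C * h\<bar> \<le> 1 * (A * y)"
    unfolding mult.assoc unfolding abs_mult[of "1 - \<rho>"] using \<rho> Ch by (intro mult_mono) auto
  have "\<bar>curvature_poly \<rho> C h\<bar> \<le> (1 + A)\<^sup>2 * y\<^sup>2 + (2 + 3 * A + A\<^sup>2) * y + 2 * ((1 + A) * y) + 1 * (A * y)"
    unfolding curvature_poly_def using 1 2 3 4 by linarith
  also have "\<dots> = (1 + A)\<^sup>2 * y\<^sup>2 + (4 + 6 * A + A\<^sup>2) * y" by (simp add: algebra_simps)
  also have "\<dots> \<le> (1 + A)\<^sup>2 * y\<^sup>2 + (4 + 6 * A + A\<^sup>2) * y\<^sup>2"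
    using y A by (intro add_left_mono mult_left_mono) (auto simp: power2_eq_square)
  also have "\<dots> \<le> 5 * (1 + A)\<^sup>2 * y\<^sup>2"
  proof -
    have "(1 + A)\<^sup>2 + (4 + 6 * A + A\<^sup>2) \<le> 5 * (1 + A)\<^sup>2"
      using A by (simp add: power2_eq_square algebra_simps)
    from mult_right_mono[OF this, of "y\<^sup>2"] show ?thesis by (simp add: algebra_simps)
  qed
  finally show ?thesis by (simp add: y_def)
qed

text \<open>
  Half of the Gaussian exponent in \<open>h\<close> absorbs the polynomial.  The other half is turned into a Gaussian in \<open>u\<close> that is
  uniform in \<open>\<rho>\<close>, using \<open>(c - w)\<^sup>2 \<ge> w\<^sup>2 / 2 - c\<^sup>2\<close> for \<open>w = sqrt (1 - \<rho>) * u\<close>.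
\<close>

lemma mixing_density_dominated:
  assumes ab: "0 < a" "b < 1" and \<rho>: "\<rho> \<in> {a<..<b}"
  shows "mixing_density c \<rho> u * (1 + (mixing_point c \<rho> u)\<^sup>2)\<^sup>2
     \<le> 64 * sqrt (1 / a) * exp (1 / 4 + c\<^sup>2 / 4) * exp (- ((1 - b) / 8) * u\<^sup>2)"
proof -
  define h where "h = mixing_point c \<rho> u"
  have r: "0 < \<rho>" "\<rho> < 1" "a < \<rho>" "\<rho> < b" using \<rho> ab by auto
  have A: "sqrt ((1 - \<rho>) / \<rho>) \<le> sqrt (1 / a)"
    using r ab by (intro real_sqrt_le_mono frac_le) auto
  have P: "\<phi> h * (1 + h\<^sup>2)\<^sup>2 \<le> 64 * exp (1/4 - h\<^sup>2 / 4)"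
  proof -
    define y where "y = (1 + h\<^sup>2) / 8"
    have y: "1 + h\<^sup>2 = 8 * y" "(1 + h\<^sup>2) / 4 = 2 * y" by (simp_all add: y_def)
    have "y \<le> exp y" using exp_ge_add_one_self[of y] by linarith
    moreover have "0 \<le> y" by (simp add: y_def)
    ultimately have "y\<^sup>2 \<le> (exp y)\<^sup>2" by (rule power_mono)
    then have "(1 + h\<^sup>2)\<^sup>2 \<le> 64 * exp ((1 + h\<^sup>2) / 4)"
      unfolding y by (simp add: power_mult_distrib exp_double)
    moreover have "\<phi> h \<le> exp (- h\<^sup>2 / 2)"
    proof -
      have "1 \<le> sqrt (2 * pi)" using pi_gt3 by simp
      then show ?thesis by (simp add: std_normal_density_def divide_simps)
    qed
    ultimately have "\<phi> h * (1 + h\<^sup>2)\<^sup>2 \<le> exp (- h\<^sup>2 / 2) * (64 * exp ((1 + h\<^sup>2) / 4))"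
      by (intro mult_mono) auto
    also have "\<dots> = 64 * exp (1/4 - h\<^sup>2 / 4)" by (simp add: exp_add[symmetric] field_simps)
    finally show ?thesis .
  qed
  have h2: "(1 - b) / 8 * u\<^sup>2 - c\<^sup>2 / 4 \<le> h\<^sup>2 / 4"
  proof -
    define w where "w = sqrt (1 - \<rho>) * u"
    have "w\<^sup>2 = (1 - \<rho>) * u\<^sup>2" using r by (simp add: w_def power_mult_distrib)
    also have "\<dots> \<ge> (1 - b) * u\<^sup>2" using r by (intro mult_right_mono) auto
    finally have w: "(1 - b) * u\<^sup>2 \<le> w\<^sup>2" .
    have "0 \<le> (2 * c - w)\<^sup>2" by simp
    then have "w\<^sup>2 / 2 - c\<^sup>2 \<le> (c - w)\<^sup>2" by (simp add: power2_eq_square algebra_simps)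
    also have "(c - w)\<^sup>2 \<le> (c - w)\<^sup>2 / \<rho>" using r by (simp add: divide_simps mult_left_le)
    also have "\<dots> = h\<^sup>2" using r by (simp add: h_def mixing_point_def w_def power_divide)
    finally show ?thesis using w by (simp add: algebra_simps)
  qed
  have "mixing_density c \<rho> u * (1 + h\<^sup>2)\<^sup>2 = sqrt ((1 - \<rho>) / \<rho>) * (\<phi> h * (1 + h\<^sup>2)\<^sup>2)"
    by (simp add: mixing_density_def h_def)
  also have "\<dots> \<le> sqrt (1 / a) * (64 * exp (1/4 - h\<^sup>2 / 4))"
    by (rule mult_mono[OF A P]) (use ab in auto)
  also have "\<dots> \<le> sqrt (1 / a) * (64 * exp ((1/4 + c\<^sup>2 / 4) + (- ((1 - b) / 8) * u\<^sup>2)))"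
    using h2 ab by (intro mult_left_mono) auto
  also have "\<dots> = 64 * sqrt (1 / a) * exp (1/4 + c\<^sup>2 / 4) * exp (- ((1 - b) / 8) * u\<^sup>2)"
    by (simp only: exp_add mult_ac)
  finally show ?thesis by (simp add: h_def)
qed

lemma integrable_exp_neg_square: "0 < \<delta> \<Longrightarrow> integrable lborel (\<lambda>u::real. exp (- \<delta> * u\<^sup>2))"
proof -
  assume d: "0 < \<delta>"
  define \<sigma> where "\<sigma> = sqrt (1 / (2 * \<delta>))"
  have s: "\<sigma>\<^sup>2 = 1 / (2 * \<delta>)" "\<sigma> > 0" using d by (auto simp: \<sigma>_def)
  have "exp (- \<delta> * u\<^sup>2) = sqrt (2 * pi * \<sigma>\<^sup>2) * normal_density 0 \<sigma> u" for u
  proof -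
    define K where "K = sqrt (2 * pi * \<sigma>\<^sup>2)"
    have "K > 0" using s(2) by (simp add: K_def zero_less_mult_iff)
    moreover have "normal_density 0 \<sigma> u = 1 / K * exp (- \<delta> * u\<^sup>2)"
      unfolding normal_density_def K_def using d by (simp add: s(1))
    ultimately show ?thesis by (simp flip: K_def)
  qed
  then show ?thesis using s by simp
qed

text \<open>
  Locally uniform domination of the density and of its first two derivatives, by one function, so that two
  differentiations under the integral are justified.
\<close>

lemma dominated_mixing_integrals:
  assumes ab: "0 < a" "b < 1"
  obtains B where "integrable lborel B"
    "\<And>\<rho> u. \<rho> \<in> {a<..<b} \<Longrightarrow> mixing_density c \<rho> u \<le> B u"
    "\<And>\<rho> u. \<rho> \<in> {a<..<b} \<Longrightarrow>
       \<bar>mixing_density c \<rho> u * (score_poly (c * sqrt \<rho>) (mixing_point c \<rho> u) / (2 * \<rho> * (1 - \<rho>)))\<bar> \<le> B u"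
    "\<And>\<rho> u. \<rho> \<in> {a<..<b} \<Longrightarrow>
       \<bar>mixing_density c \<rho> u * (curvature_poly \<rho> (c * sqrt \<rho>) (mixing_point c \<rho> u) / (2 * \<rho> * (1 - \<rho>))\<^sup>2)\<bar> \<le> B u"
proof -
  define R where "R = 1 + 1 / (2 * a * (1 - b))"
  define A where "A = 5 * (1 + \<bar>c\<bar>)\<^sup>2"
  define B where "B u = A * R\<^sup>2 * (64 * sqrt (1 / a) * exp (1 / 4 + c\<^sup>2 / 4) * exp (- ((1 - b) / 8) * u\<^sup>2))" for u
  have A: "1 \<le> A" "1 + \<bar>c\<bar> \<le> A"
  proof -
    have "1 + \<bar>c\<bar> \<le> (1 + \<bar>c\<bar>)\<^sup>2" by (simp add: power2_eq_square algebra_simps)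
    then show "1 + \<bar>c\<bar> \<le> A" by (simp add: A_def)
    then show "1 \<le> A" by simp
  qed
  have main: "\<bar>mixing_density c \<rho> u * (p / d)\<bar> \<le> B u"
    if \<rho>: "\<rho> \<in> {a<..<b}" and p: "\<bar>p\<bar> \<le> A * (1 + (mixing_point c \<rho> u)\<^sup>2)\<^sup>2" and d: "1 / d \<le> R\<^sup>2" "0 < d" for \<rho> u p d
  proof -
    have r: "0 < \<rho>" "\<rho> < 1" using \<rho> ab by auto
    let ?y = "(1 + (mixing_point c \<rho> u)\<^sup>2)\<^sup>2"
    have "\<bar>mixing_density c \<rho> u * (p / d)\<bar> = mixing_density c \<rho> u * (\<bar>p\<bar> * (1 / d))"
      using mixing_density_nonneg[OF r] d by (simp add: abs_mult)
    also have "\<dots> \<le> mixing_density c \<rho> u * ((A * ?y) * R\<^sup>2)"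
      using p d A by (intro mult_left_mono mult_mono mixing_density_nonneg r) auto
    also have "\<dots> = A * R\<^sup>2 * (mixing_density c \<rho> u * ?y)" by (simp only: mult_ac)
    also have "\<dots> \<le> B u"
      unfolding B_def using A by (intro mult_left_mono mixing_density_dominated[OF ab \<rho>]) auto
    finally show ?thesis .
  qed
  have R: "1 \<le> R" "1 \<le> R\<^sup>2" "R \<le> R\<^sup>2" if "a < b"
  proof -
    show R1: "1 \<le> R" using ab that by (simp add: R_def)
    then show "1 \<le> R\<^sup>2" by (simp add: one_le_power)
    show "R \<le> R\<^sup>2" using R1 by (simp add: power2_eq_square)
  qed
  have E: "0 < 2 * \<rho> * (1 - \<rho>)" "1 / (2 * \<rho> * (1 - \<rho>)) \<le> R" if \<rho>: "\<rho> \<in> {a<..<b}" for \<rho>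
  proof -
    show "0 < 2 * \<rho> * (1 - \<rho>)" using \<rho> ab by simp
    have "2 * a * (1 - b) \<le> 2 * \<rho> * (1 - \<rho>)" using \<rho> ab by (intro mult_mono) auto
    then have "1 / (2 * \<rho> * (1 - \<rho>)) \<le> 1 / (2 * a * (1 - b))" using ab by (intro divide_left_mono) (use \<rho> in auto)
    then show "1 / (2 * \<rho> * (1 - \<rho>)) \<le> R" by (simp add: R_def)
  qed
  have C: "\<bar>c * sqrt \<rho>\<bar> \<le> \<bar>c\<bar>" if \<rho>: "\<rho> \<in> {a<..<b}" for \<rho>
    using \<rho> ab by (simp add: abs_mult mult_left_le)
  show thesis
  proof (rule that)
    show "integrable lborel B" unfolding B_def[abs_def]
      using ab by (intro integrable_mult_right integrable_exp_neg_square) simp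
  next
    fix \<rho> u assume \<rho>: "\<rho> \<in> {a<..<b}"
    then have "a < b" by simp
    note R = R[OF this]
    have y: "1 \<le> 1 + (mixing_point c \<rho> u)\<^sup>2" by simp
    have y2: "1 + (mixing_point c \<rho> u)\<^sup>2 \<le> (1 + (mixing_point c \<rho> u)\<^sup>2)\<^sup>2"
      using mult_right_mono[OF y, of "1 + (mixing_point c \<rho> u)\<^sup>2"] by (simp add: power2_eq_square[of "1 + _"])
    have "\<bar>mixing_density c \<rho> u * (1 / 1)\<bar> \<le> B u"
    proof (rule main[OF \<rho>])
      have "1 * 1 \<le> A * (1 + (mixing_point c \<rho> u)\<^sup>2)\<^sup>2"
        using A y y2 by (intro mult_mono) auto
      then show "\<bar>1\<bar> \<le> A * (1 + (mixing_point c \<rho> u)\<^sup>2)\<^sup>2" by simp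
    qed (use R in auto)
    then show "mixing_density c \<rho> u \<le> B u" by simp
    show "\<bar>mixing_density c \<rho> u * (score_poly (c * sqrt \<rho>) (mixing_point c \<rho> u) / (2 * \<rho> * (1 - \<rho>)))\<bar> \<le> B u"
    proof (rule main[OF \<rho>])
      have "\<bar>score_poly (c * sqrt \<rho>) (mixing_point c \<rho> u)\<bar> \<le> (1 + \<bar>c\<bar>) * (1 + (mixing_point c \<rho> u)\<^sup>2)"
        by (rule score_poly_bound[OF C[OF \<rho>]])
      also have "\<dots> \<le> A * (1 + (mixing_point c \<rho> u)\<^sup>2)\<^sup>2"
        using A y2 by (intro mult_mono) auto
      finally show "\<bar>score_poly (c * sqrt \<rho>) (mixing_point c \<rho> u)\<bar> \<le> A * (1 + (mixing_point c \<rho> u)\<^sup>2)\<^sup>2" .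
      show "1 / (2 * \<rho> * (1 - \<rho>)) \<le> R\<^sup>2" using E[OF \<rho>] R by linarith
    qed (use E[OF \<rho>] in auto)
    show "\<bar>mixing_density c \<rho> u * (curvature_poly \<rho> (c * sqrt \<rho>) (mixing_point c \<rho> u) / (2 * \<rho> * (1 - \<rho>))\<^sup>2)\<bar> \<le> B u"
    proof (rule main[OF \<rho>])
      show "\<bar>curvature_poly \<rho> (c * sqrt \<rho>) (mixing_point c \<rho> u)\<bar> \<le> A * (1 + (mixing_point c \<rho> u)\<^sup>2)\<^sup>2"
        unfolding A_def using \<rho> ab by (intro curvature_poly_bound C) auto
      show "1 / (2 * \<rho> * (1 - \<rho>))\<^sup>2 \<le> R\<^sup>2"
        using power_mono[OF E(2)[OF \<rho>], of 2] E(1)[OF \<rho>] by (simp add: power_divide)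
      show "0 < (2 * \<rho> * (1 - \<rho>))\<^sup>2" using E(1)[OF \<rho>] by (intro zero_less_power)
    qed
  qed
qed

lemma mixture_twice_differentiable:
  fixes g :: "real \<Rightarrow> real" and c :: real
  assumes [measurable]: "g \<in> borel_measurable borel" and g: "\<And>u. 0 \<le> g u" "\<And>u. g u \<le> 1"
    and \<rho>: "0 < \<rho>" "\<rho> < 1"
  defines "D \<equiv> (\<lambda>\<rho>. \<integral>u. g u * (mixing_density c \<rho> u * (score_poly (c * sqrt \<rho>) (mixing_point c \<rho> u) / (2 * \<rho> * (1 - \<rho>)))) \<partial>lborel)"
  shows "((\<lambda>\<rho>. \<integral>u. g u * mixing_density c \<rho> u \<partial>lborel) has_real_derivative D \<rho>) (at \<rho>)"
    and "(D has_real_derivative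
      (\<integral>u. g u * (mixing_density c \<rho> u * (curvature_poly \<rho> (c * sqrt \<rho>) (mixing_point c \<rho> u) / (2 * \<rho> * (1 - \<rho>))\<^sup>2)) \<partial>lborel)) (at \<rho>)"
proof -
  define a b where "a = \<rho> / 2" and "b = (1 + \<rho>) / 2"
  have ab: "0 < a" "b < 1" and \<rho>ab: "\<rho> \<in> {a<..<b}" using \<rho> by (auto simp: a_def b_def)
  obtain B where B: "integrable lborel B"
    "\<And>\<rho> u. \<rho> \<in> {a<..<b} \<Longrightarrow> mixing_density c \<rho> u \<le> B u"
    "\<And>\<rho> u. \<rho> \<in> {a<..<b} \<Longrightarrow>
       \<bar>mixing_density c \<rho> u * (score_poly (c * sqrt \<rho>) (mixing_point c \<rho> u) / (2 * \<rho> * (1 - \<rho>)))\<bar> \<le> B u"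
    "\<And>\<rho> u. \<rho> \<in> {a<..<b} \<Longrightarrow>
       \<bar>mixing_density c \<rho> u * (curvature_poly \<rho> (c * sqrt \<rho>) (mixing_point c \<rho> u) / (2 * \<rho> * (1 - \<rho>))\<^sup>2)\<bar> \<le> B u"
    using dominated_mixing_integrals[OF ab, of c] by blast
  have r: "0 < y" "y < 1" if "y \<in> {a<..<b}" for y using that ab by auto
  have weight: "\<bar>g u * x\<bar> \<le> B u" if "\<bar>x\<bar> \<le> B u" for u x
    using mult_mono[OF g(2)[of u] that] g(1)[of u] by (simp add: abs_mult)
  have int0: "integrable lborel (\<lambda>u. g u * mixing_density c y u)" if y: "y \<in> {a<..<b}" for y
  proof (rule Bochner_Integration.integrable_bound[OF B(1)])
    show "AE u in lborel. norm (g u * mixing_density c y u) \<le> norm (B u)"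
      using weight[of "mixing_density c y _"] B(2)[OF y] mixing_density_nonneg[OF r[OF y]]
      by (intro AE_I2) (smt (verit) real_norm_def)
  qed measurable
  have int1: "integrable lborel (\<lambda>u. g u * (mixing_density c y u * (score_poly (c * sqrt y) (mixing_point c y u) / (2 * y * (1 - y)))))"
    if y: "y \<in> {a<..<b}" for y
  proof (rule Bochner_Integration.integrable_bound[OF B(1)])
    show "AE u in lborel. norm (g u * (mixing_density c y u * (score_poly (c * sqrt y) (mixing_point c y u) / (2 * y * (1 - y))))) \<le> norm (B u)"
      using weight[OF B(3)[OF y]] by (intro AE_I2) (smt (verit) real_norm_def)
  qed measurable
  show "((\<lambda>\<rho>. \<integral>u. g u * mixing_density c \<rho> u \<partial>lborel) has_real_derivative D \<rho>) (at \<rho>)"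
    unfolding D_def
  proof (rule DERIV_integral_dominated[OF \<rho>ab int0 _ weight[OF B(3)] B(1)])
    show "((\<lambda>y. g u * mixing_density c y u) has_real_derivative
       g u * (mixing_density c y u * (score_poly (c * sqrt y) (mixing_point c y u) / (2 * y * (1 - y))))) (at y)"
      if "y \<in> {a<..<b}" for y u
      using r[OF that] by (intro DERIV_cmult DERIV_mixing_density)
  qed (simp_all, measurable)
  show "(D has_real_derivative
      (\<integral>u. g u * (mixing_density c \<rho> u * (curvature_poly \<rho> (c * sqrt \<rho>) (mixing_point c \<rho> u) / (2 * \<rho> * (1 - \<rho>))\<^sup>2)) \<partial>lborel)) (at \<rho>)"
    unfolding D_def
  proof (rule DERIV_integral_dominated[OF \<rho>ab int1 _ weight[OF B(4)] B(1)])
    show "((\<lambda>y. g u * (mixing_density c y u * (score_poly (c * sqrt y) (mixing_point c y u) / (2 * y * (1 - y))))) has_real_derivative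
       g u * (mixing_density c y u * (curvature_poly y (c * sqrt y) (mixing_point c y u) / (2 * y * (1 - y))\<^sup>2))) (at y)"
      if "y \<in> {a<..<b}" for y u
      using r[OF that] by (intro DERIV_cmult DERIV2_mixing_density)
  qed (simp_all, measurable)
qed

section \<open>Gaussian tail bounds\<close>

lemma std_normal_mgf:
  "has_bochner_integral lborel (\<lambda>z. \<phi> z * exp (t * z)) (exp (t\<^sup>2 / 2))"
proof -
  have "\<phi> z * exp (t * z) = exp (t\<^sup>2 / 2) * normal_density t 1 z" for z
    by (simp add: normal_density_def exp_add[symmetric] power2_eq_square field_simps)
  then show ?thesis
    using has_bochner_integral_mult_right[of "exp (t\<^sup>2/2)" lborel "normal_density t 1" 1]
    by (simp add: has_bochner_integral_iff)
qed

lemma integrable_std_normal_times: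
  assumes [measurable]: "f \<in> borel_measurable borel" and f: "\<And>z. \<bar>f z\<bar> \<le> 1"
  shows "integrable lborel (\<lambda>z. \<phi> z * f z)"
proof (rule Bochner_Integration.integrable_bound)
  show "integrable lborel \<phi>" by (rule integrable_normal_density) simp
  show "AE z in lborel. norm (\<phi> z * f z) \<le> norm (\<phi> z)"
    using f by (intro AE_I2) (simp add: abs_mult mult_left_le)
qed measurable

lemma std_normal_density_antimono: "0 \<le> x \<Longrightarrow> x \<le> y \<Longrightarrow> \<phi> y \<le> \<phi> x"
  by (simp add: std_normal_density_def divide_right_mono power_mono)

text \<open>
  A crude lower bound which only uses the interval from \<open>x\<close> to \<open>x + 1\<close>.  The loss is a factor \<open>exp (O(x))\<close>, harmless against the
  gaps of order \<open>exp (- \<delta> * x\<^sup>2)\<close> that decide the comparisons below.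
\<close>

lemma std_normal_unit_interval:
  assumes "0 \<le> x" and [measurable]: "f \<in> borel_measurable borel"
    and f: "\<And>z. 0 \<le> f z" "\<And>z. f z \<le> 1" "\<And>z. x < z \<Longrightarrow> b \<le> f z" and b: "0 \<le> b"
  shows "b * \<phi> (x + 1) \<le> (\<integral>z. \<phi> z * f z \<partial>lborel)"
proof -
  have "b * \<phi> (x + 1) = (\<integral>z. (b * \<phi> (x + 1)) * indicator {x<..x + 1} z \<partial>lborel)" by simp
  also have "\<dots> \<le> (\<integral>z. \<phi> z * f z \<partial>lborel)"
  proof (rule integral_mono)
    show "integrable lborel (\<lambda>z. (b * \<phi> (x + 1)) * indicator {x<..x + 1} z)" by simp
    show "integrable lborel (\<lambda>z. \<phi> z * f z)"
      using f by (intro integrable_std_normal_times) auto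
    show "b * \<phi> (x + 1) * indicator {x<..x + 1} z \<le> \<phi> z * f z" for z
    proof (cases "z \<in> {x<..x + 1}")
      case True
      then have "\<phi> (x + 1) * b \<le> \<phi> z * f z" using assms by (intro mult_mono std_normal_density_antimono) auto
      with True show ?thesis by (simp add: mult.commute)
    qed (use f in simp)
  qed
  finally show ?thesis .
qed

lemma std_normal_upper_tail: "1 - \<Phi> x = (\<integral>z. \<phi> z * indicator {x<..} z \<partial>lborel)"
proof -
  interpret N: real_distribution gauss by (rule real_dist_normal_dist)
  have "1 - \<Phi> x = measure gauss {x<..}"
    using N.prob_compl[of "{..x}"] by (simp add: cdf_def2 Compl_eq_Diff_UNIV[symmetric] Compl_atMost)
  also have "\<dots> = (\<integral>z. indicator {x<..} z \<partial>gauss)" by simp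
  also have "\<dots> = (\<integral>z. \<phi> z * indicator {x<..} z \<partial>lborel)" by (rule integral_std_normal) simp
  finally show ?thesis .
qed

lemma std_normal_cdf_minus: "\<Phi> (- x) = 1 - \<Phi> x"
proof -
  have "\<Phi> (- x) = (\<integral>z. indicator {..- x} z \<partial>gauss)" by (simp add: cdf_def2)
  also have "\<dots> = (\<integral>z. \<phi> z * indicator {..- x} z \<partial>lborel)" by (rule integral_std_normal) simp
  also have "\<dots> = (\<integral>z. \<phi> (- z) * indicator {..- x} (- z) \<partial>lborel)"
    using lborel_integral_real_affine[of "- 1" "\<lambda>z. \<phi> z * indicator {..- x} z" 0] by simp
  also have "\<dots> = (\<integral>z. \<phi> z * indicator {x<..} z \<partial>lborel)"
  proof (rule integral_cong_AE)
    have "AE z in lborel. z \<noteq> x" by (rule AE_lborel_singleton)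
    then show "AE z in lborel. \<phi> (- z) * indicator {..- x} (- z) = \<phi> z * indicator {x<..} z"
      by eventually_elim (auto simp: std_normal_density_def indicator_def)
  qed measurable
  finally show ?thesis by (simp add: std_normal_upper_tail)
qed

lemma std_normal_tail_lower: "0 \<le> x \<Longrightarrow> \<phi> (x + 1) \<le> 1 - \<Phi> x"
proof -
  assume x: "0 \<le> x"
  have "1 * \<phi> (x + 1) \<le> (\<integral>z. \<phi> z * indicator {x<..} z \<partial>lborel)"
    by (rule std_normal_unit_interval[OF x]) (auto simp: indicator_def)
  then show ?thesis by (simp add: std_normal_upper_tail)
qed

text \<open>
  Chernoff's bound: the indicator of \<open>S\<close> is at most \<open>exp (t * (z - x))\<close>.
\<close>

lemma std_normal_chernoff:
  assumes "0 \<le> t" and [measurable]: "S \<in> sets borel" and S: "\<And>z. z \<in> S \<Longrightarrow> x \<le> z"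
  shows "(\<integral>z. \<phi> z * indicator S z \<partial>lborel) \<le> exp (t\<^sup>2 / 2 - t * x)"
proof -
  have "(\<integral>z. \<phi> z * indicator S z \<partial>lborel) \<le> (\<integral>z. exp (- (t * x)) * (\<phi> z * exp (t * z)) \<partial>lborel)"
  proof (rule integral_mono)
    show "integrable lborel (\<lambda>z. \<phi> z * indicator S z)"
      by (intro integrable_std_normal_times) (auto simp: indicator_def)
    show "integrable lborel (\<lambda>z. exp (- (t * x)) * (\<phi> z * exp (t * z)))"
      using std_normal_mgf by (simp add: has_bochner_integral_iff)
    show "\<phi> z * indicator S z \<le> exp (- (t * x)) * (\<phi> z * exp (t * z))" for z
    proof (cases "z \<in> S")
      case True
      then have "1 \<le> exp (t * z - t * x)" using S[OF True] assms(1) by (simp add: mult_left_mono)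
      then have "\<phi> z * 1 \<le> \<phi> z * exp (t * z - t * x)" by (intro mult_left_mono) auto
      then show ?thesis using True by (simp add: exp_diff exp_minus field_simps)
    qed simp
  qed
  also have "\<dots> = exp (- (t * x)) * exp (t\<^sup>2 / 2)"
    using std_normal_mgf by (simp add: has_bochner_integral_iff)
  also have "\<dots> = exp (t\<^sup>2 / 2 - t * x)" by (simp add: exp_add[symmetric])
  finally show ?thesis .
qed

lemma std_normal_tail_upper:
  assumes "0 \<le> x" shows "1 - \<Phi> x \<le> exp (- x\<^sup>2 / 2)"
  using std_normal_chernoff[of x "{x<..}" x] assms
  by (simp add: std_normal_upper_tail power2_eq_square field_simps)

section \<open>Size of the family wise error rate\<close>

text \<open>
  The factor \<open>z = critical_slope \<rho> * c\<close> is the one that makes the noise threshold equal to \<open>c\<close>.  Written in this form,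
  the quotient is also meaningful, and equal to 0, at \<open>\<rho> = 0\<close>, and its monotonicity in \<open>\<rho>\<close> is evident.
\<close>

definition critical_slope :: "real \<Rightarrow> real" where
  "critical_slope \<rho> = sqrt \<rho> / (1 + sqrt (1 - \<rho>))"

definition rejection_given :: "nat \<Rightarrow> real \<Rightarrow> real \<Rightarrow> real \<Rightarrow> real" where
  "rejection_given n c \<rho> z = 1 - \<Phi> ((c - sqrt \<rho> * z) / sqrt (1 - \<rho>)) ^ n"

text \<open>
  By \<open>equicorrelated_acceptance_probability\<close> below, this is the family wise error rate under equicorrelation \<open>\<rho>\<close>.
\<close>

definition fwer :: "nat \<Rightarrow> real \<Rightarrow> real \<Rightarrow> real" where
  "fwer n c \<rho> = (\<integral>z. \<phi> z * rejection_given n c \<rho> z \<partial>lborel)"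

lemma critical_slope_bounds:
  assumes "0 < \<rho>" "\<rho> < 1"
  shows "0 < critical_slope \<rho>" "critical_slope \<rho> < sqrt \<rho>" "critical_slope \<rho> \<le> sqrt \<rho> / sqrt (1 - \<rho>)"
proof -
  have s: "0 < sqrt (1 - \<rho>)" "0 < sqrt \<rho>" using assms by auto
  show "0 < critical_slope \<rho>" unfolding critical_slope_def using s by (intro divide_pos_pos add_pos_pos) auto
  show "critical_slope \<rho> < sqrt \<rho>" unfolding critical_slope_def
    using divide_strict_left_mono[of 1 "1 + sqrt (1 - \<rho>)" "sqrt \<rho>"] s by simp
  show "critical_slope \<rho> \<le> sqrt \<rho> / sqrt (1 - \<rho>)"
    unfolding critical_slope_def using s by (intro divide_left_mono mult_pos_pos add_pos_pos) auto
qed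

lemma critical_slope_eq:
  assumes "0 \<le> \<rho>" "\<rho> < 1" shows "sqrt \<rho> * critical_slope \<rho> = 1 - sqrt (1 - \<rho>)"
proof -
  have "sqrt \<rho> * sqrt \<rho> = (1 - sqrt (1 - \<rho>)) * (1 + sqrt (1 - \<rho>))"
    using assms by (simp add: algebra_simps)
  moreover have "1 + sqrt (1 - \<rho>) > 0" using assms by (smt (verit) real_sqrt_ge_zero)
  ultimately show ?thesis by (simp add: critical_slope_def divide_simps)
qed

lemma critical_slope_strict_mono:
  assumes "0 \<le> x" "x < y" "y < 1" shows "critical_slope x < critical_slope y"
  unfolding critical_slope_def using assms by (intro frac_less) (auto intro: add_pos_nonneg)

lemma std_normal_cdf_01: "0 \<le> \<Phi> x" "\<Phi> x \<le> 1"
proof -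
  interpret N: real_distribution gauss by (rule real_dist_normal_dist)
  show "0 \<le> \<Phi> x" "\<Phi> x \<le> 1" by (auto intro: N.cdf_nonneg N.cdf_bounded_prob)
qed

lemma std_normal_cdf_mono: "x \<le> y \<Longrightarrow> \<Phi> x \<le> \<Phi> y"
proof -
  interpret N: real_distribution gauss by (rule real_dist_normal_dist)
  show "x \<le> y \<Longrightarrow> \<Phi> x \<le> \<Phi> y" by (rule N.cdf_nondecreasing)
qed

lemma measurable_std_normal_cdf [measurable]: "\<Phi> \<in> borel_measurable borel"
  by (intro borel_measurable_mono monoI std_normal_cdf_mono)

lemma measurable_rejection_given [measurable]: "rejection_given n c \<rho> \<in> borel_measurable borel"
  unfolding rejection_given_def[abs_def] by measurable

lemma rejection_given_01: "0 \<le> rejection_given n c \<rho> z" "rejection_given n c \<rho> z \<le> 1"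
  unfolding rejection_given_def using std_normal_cdf_01 by (auto intro: power_le_one)

lemma integrable_rejection_given: "integrable lborel (\<lambda>z. \<phi> z * rejection_given n c \<rho> z)"
  using rejection_given_01[of n c \<rho>]
  by (intro integrable_std_normal_times) auto

text \<open>
  To the right of the critical factor the bound exceeds 1.  To the left, use the union bound and \<open>1 - \<Phi> u \<le> exp (- u\<^sup>2 / 2)\<close>,
  where \<open>n\<close> is at most of the order \<open>exp ((c + 1)\<^sup>2 / 2)\<close> and \<open>u\<^sup>2\<close> is bounded below by its tangent at \<open>c\<close>.
  The true exponential rate is \<open>sqrt \<rho> / sqrt (1 - \<rho>)\<close>; the smaller rate \<open>critical_slope \<rho>\<close> is chosen because it is the
  optimal Chernoff parameter in \<open>fwer_le\<close>.
\<close>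

lemma rejection_given_le:
  assumes \<rho>: "0 < \<rho>" "\<rho> < 1" and c: "0 \<le> c" and n: "real n * (1 - \<Phi> c) \<le> 1"
  shows "rejection_given n c \<rho> z
     \<le> sqrt (2 * pi) * exp (c + 1 / 2 + c * critical_slope \<rho> * (z - critical_slope \<rho> * c))"
proof (cases "z \<le> critical_slope \<rho> * c")
  case False
  have "1 * 1 \<le> sqrt (2 * pi) * exp (c + 1 / 2 + c * critical_slope \<rho> * (z - critical_slope \<rho> * c))"
    using False c critical_slope_bounds[OF \<rho>] pi_gt3 by (intro mult_mono) auto
  then show ?thesis using rejection_given_01[of n c \<rho> z] by linarith
next
  case True
  define \<kappa> where "\<kappa> = critical_slope \<rho>"
  define s where "s = sqrt (1 - \<rho>)"
  define u where "u = (c - sqrt \<rho> * z) / s"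
  have s: "s > 0" using \<rho> by (simp add: s_def)
  have "u - c = (c - sqrt \<rho> * z - c * s) / s" using s by (simp add: u_def field_simps)
  also have "c - sqrt \<rho> * z - c * s = sqrt \<rho> * (\<kappa> * c - z)"
  proof -
    have "sqrt \<rho> * (\<kappa> * c - z) = (sqrt \<rho> * \<kappa>) * c - sqrt \<rho> * z" by (simp add: algebra_simps)
    also have "sqrt \<rho> * \<kappa> = 1 - s" using critical_slope_eq[of \<rho>] \<rho> by (simp add: \<kappa>_def s_def)
    finally show ?thesis by (simp add: algebra_simps)
  qed
  also have "sqrt \<rho> * (\<kappa> * c - z) / s = sqrt \<rho> / s * (\<kappa> * c - z)" by simp
  finally have uc: "u - c = sqrt \<rho> / s * (\<kappa> * c - z)" .
  have "\<kappa> * (\<kappa> * c - z) \<le> u - c"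
    unfolding uc using critical_slope_bounds(3)[OF \<rho>] True by (intro mult_right_mono) (auto simp: \<kappa>_def s_def)
  then have "c * (\<kappa> * (\<kappa> * c - z)) \<le> c * (u - c)" using c by (intro mult_left_mono)
  moreover have "0 \<le> (u - c)\<^sup>2" by simp
  ultimately have u2: "c\<^sup>2 - 2 * (c * \<kappa> * (z - \<kappa> * c)) \<le> u\<^sup>2"
    by (simp add: power2_eq_square algebra_simps)
  have "0 \<le> u - c" unfolding uc using True s \<rho> by (auto simp: \<kappa>_def)
  then have u0: "0 \<le> u" using c by simp
  have "real n * \<phi> (c + 1) \<le> 1"
    using mult_left_mono[OF std_normal_tail_lower[OF c], of "real n"] n by simp
  then have "real n \<le> 1 / \<phi> (c + 1)" by (simp add: pos_le_divide_eq normal_density_pos)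
  also have "\<dots> = sqrt (2 * pi) * exp ((c + 1)\<^sup>2 / 2)" by (simp add: std_normal_density_def exp_minus field_simps)
  finally have n': "real n \<le> sqrt (2 * pi) * exp ((c + 1)\<^sup>2 / 2)" .
  (* Bernoulli's inequality plays the part of the union bound *)
  have "1 + real n * (\<Phi> u - 1) \<le> (1 + (\<Phi> u - 1)) ^ n"
    using std_normal_cdf_01(1)[of u] by (intro Bernoulli_inequality) simp
  then have "rejection_given n c \<rho> z \<le> real n * (1 - \<Phi> u)"
    by (simp add: rejection_given_def u_def s_def algebra_simps)
  also have "\<dots> \<le> (sqrt (2 * pi) * exp ((c + 1)\<^sup>2 / 2)) * exp (- u\<^sup>2 / 2)"
    using n' std_normal_tail_upper[OF u0] std_normal_cdf_01[of u] by (intro mult_mono) auto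
  also have "\<dots> = sqrt (2 * pi) * exp ((c + 1)\<^sup>2 / 2 - u\<^sup>2 / 2)" by (simp add: exp_add[symmetric] mult.assoc)
  also have "\<dots> \<le> sqrt (2 * pi) * exp (c + 1 / 2 + c * \<kappa> * (z - \<kappa> * c))"
  proof -
    have eq: "(c + 1)\<^sup>2 / 2 = c\<^sup>2 / 2 + c + 1 / 2" by (simp add: power2_sum add_divide_distrib)
    have "(c + 1)\<^sup>2 / 2 - u\<^sup>2 / 2 \<le> c + 1 / 2 + c * \<kappa> * (z - \<kappa> * c)" unfolding eq using u2 by linarith
    then show ?thesis by (intro mult_left_mono) auto
  qed
  finally show ?thesis by (simp add: \<kappa>_def)
qed

text \<open>
  Beyond the critical factor each hypothesis is rejected with conditional probability at least \<open>1 - \<Phi> c\<close>, independently.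
\<close>

lemma rejection_given_ge:
  assumes \<rho>: "0 \<le> \<rho>" "\<rho> < 1" and z: "critical_slope \<rho> * c \<le> z" and n: "\<beta> \<le> real n * (1 - \<Phi> c)"
  shows "1 - exp (- \<beta>) \<le> rejection_given n c \<rho> z"
proof -
  define s where "s = sqrt (1 - \<rho>)"
  define u where "u = (c - sqrt \<rho> * z) / s"
  have s: "s > 0" using \<rho> by (simp add: s_def)
  have "sqrt \<rho> * (critical_slope \<rho> * c) \<le> sqrt \<rho> * z" using z \<rho> by (intro mult_left_mono) auto
  then have "(1 - s) * c \<le> sqrt \<rho> * z"
    using critical_slope_eq[OF \<rho>] by (simp add: s_def mult.assoc[symmetric])
  then have "u \<le> c" using s by (simp add: u_def divide_le_eq algebra_simps)
  then have "\<Phi> u ^ n \<le> \<Phi> c ^ n" using std_normal_cdf_01 by (intro power_mono std_normal_cdf_mono)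
  (* x \<le> exp (x - 1) turns the power into exp (- n * (1 - \<Phi> c)) *)
  also have "\<dots> \<le> exp (\<Phi> c - 1) ^ n"
    using exp_ge_add_one_self[of "\<Phi> c - 1"] std_normal_cdf_01 by (intro power_mono) auto
  also have "\<dots> = exp (- (real n * (1 - \<Phi> c)))" by (simp add: exp_of_nat_mult[symmetric] algebra_simps)
  also have "\<dots> \<le> exp (- \<beta>)" using n by simp
  finally show ?thesis by (simp add: rejection_given_def u_def s_def)
qed

text \<open>
  The bound on the conditional rejection probability is an exponential in \<open>z\<close> with rate \<open>critical_slope \<rho> * c\<close>, so its mean
  is a value of the Gaussian moment generating function.
\<close>

lemma fwer_le:
  assumes \<rho>: "0 < \<rho>" "\<rho> < 1" and c: "0 \<le> c" and n: "real n * (1 - \<Phi> c) \<le> 1"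
  shows "fwer n c \<rho> \<le> sqrt (2 * pi) * exp (c + 1 / 2 - (critical_slope \<rho> * c)\<^sup>2 / 2)"
proof -
  define t where "t = critical_slope \<rho> * c"
  have "fwer n c \<rho> \<le> (\<integral>z. (sqrt (2 * pi) * exp (c + 1 / 2 - t\<^sup>2)) * (\<phi> z * exp (t * z)) \<partial>lborel)"
    unfolding fwer_def
  proof (rule integral_mono[OF integrable_rejection_given])
    show "integrable lborel (\<lambda>z. (sqrt (2 * pi) * exp (c + 1 / 2 - t\<^sup>2)) * (\<phi> z * exp (t * z)))"
      using std_normal_mgf by (simp add: has_bochner_integral_iff)
    fix z
    have "\<phi> z * rejection_given n c \<rho> z \<le> \<phi> z * (sqrt (2 * pi) * exp (c + 1 / 2 + c * critical_slope \<rho> * (z - critical_slope \<rho> * c)))"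
      using rejection_given_le[OF assms] by (intro mult_left_mono) auto
    also have "c + 1 / 2 + c * critical_slope \<rho> * (z - critical_slope \<rho> * c) = (c + 1 / 2 - t\<^sup>2) + t * z"
      by (simp add: t_def power2_eq_square algebra_simps)
    finally show "\<phi> z * rejection_given n c \<rho> z \<le> (sqrt (2 * pi) * exp (c + 1 / 2 - t\<^sup>2)) * (\<phi> z * exp (t * z))"
      by (simp add: exp_add mult_ac)
  qed
  also have "\<dots> = (sqrt (2 * pi) * exp (c + 1 / 2 - t\<^sup>2)) * exp (t\<^sup>2 / 2)"
    using std_normal_mgf[of t] by (simp add: has_bochner_integral_iff)
  also have "\<dots> = sqrt (2 * pi) * exp (c + 1 / 2 - t\<^sup>2 / 2)"
    by (simp add: mult.assoc exp_add[symmetric])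
  finally show ?thesis by (simp add: t_def)
qed

lemma fwer_ge:
  assumes \<rho>: "0 \<le> \<rho>" "\<rho> < 1" and c: "0 \<le> c" and \<beta>: "0 \<le> \<beta>" "\<beta> \<le> real n * (1 - \<Phi> c)"
  shows "(1 - exp (- \<beta>)) * \<phi> (critical_slope \<rho> * c + 1) \<le> fwer n c \<rho>"
  unfolding fwer_def
proof (rule std_normal_unit_interval)
  show "0 \<le> critical_slope \<rho> * c" using \<rho> c by (auto simp: critical_slope_def intro!: mult_nonneg_nonneg divide_nonneg_nonneg)
qed (use rejection_given_ge[OF \<rho> _ \<beta>(2)] \<beta> in \<open>auto simp: rejection_given_01\<close>)

section \<open>Sign of the second derivative\<close>

text \<open>
  With \<open>q = h * (h - C)\<close> the polynomial is \<open>(q - 1)\<^sup>2\<close> plus terms controlled by \<open>\<bar>q\<bar>\<close> and \<open>h\<^sup>2 + C\<^sup>2\<close>, hence at least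
  \<open>q\<^sup>2 / 4 - 4 * (h\<^sup>2 + C\<^sup>2) - 7\<close>.  If \<open>h\<close> has distance at least 32 from both zeros of \<open>q\<close>, then
  \<open>q\<^sup>2 \<ge> 128 * (h\<^sup>2 + C\<^sup>2)\<close>, because one of \<open>\<bar>h\<bar>\<close> and \<open>\<bar>h - C\<bar>\<close> is comparable with \<open>sqrt (h\<^sup>2 + C\<^sup>2)\<close>; the
  constant 32 is large enough for this to dominate.  Otherwise \<open>h\<^sup>2 + C\<^sup>2\<close> is of order \<open>C\<^sup>2\<close>.  The second penalty zone
  is a half-line rather than an interval so that it can be estimated by a Gaussian tail.
\<close>

lemma curvature_poly_ge:
  assumes \<rho>: "0 < \<rho>" "\<rho> < 1" and C: "1 \<le> C"
  shows "1 - 9000 * C\<^sup>2 * (indicator {-32..32} h + indicator {C - 32..} h) \<le> curvature_poly \<rho> C h"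
proof -
  define q where "q = h * (h - C)"
  have sp: "score_poly C h = q - 1" by (simp add: score_poly_def q_def power2_eq_square algebra_simps)
  have C2: "1 \<le> C\<^sup>2" using C by (simp add: one_le_power)
  have 1: "q\<^sup>2 / 2 - 1 \<le> (q - 1)\<^sup>2"
  proof -
    have "0 \<le> (q - 2)\<^sup>2" by simp
    then show ?thesis by (simp add: power2_eq_square algebra_simps)
  qed
  have 2: "2 * (1 - 2 * \<rho>) * (q - 1) \<le> q\<^sup>2 / 4 + 6"
  proof -
    have "\<bar>(1 - 2 * \<rho>) * (q - 1)\<bar> \<le> 1 * (\<bar>q\<bar> + 1)"
      unfolding abs_mult using \<rho> by (intro mult_mono) auto
    then have "2 * ((1 - 2 * \<rho>) * (q - 1)) \<le> 2 * (\<bar>q\<bar> + 1)" using abs_le_D1 by simp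
    moreover have "0 \<le> (\<bar>q\<bar> / 2 - 2)\<^sup>2" by simp
    then have "2 * \<bar>q\<bar> \<le> q\<^sup>2 / 4 + 4" by (simp add: power2_diff power_divide)
    ultimately show ?thesis unfolding mult.assoc by simp
  qed
  have Ch: "\<bar>C * h\<bar> \<le> (h\<^sup>2 + C\<^sup>2) / 2"
  proof -
    have "0 \<le> (\<bar>C\<bar> - \<bar>h\<bar>)\<^sup>2" by simp
    then show ?thesis by (simp add: power2_diff abs_mult)
  qed
  have 3: "(2 * h - C) * (h - C) \<le> 7 / 2 * h\<^sup>2 + 5 / 2 * C\<^sup>2"
  proof -
    have eq: "(2 * h - C) * (h - C) = 2 * h\<^sup>2 - 3 * (C * h) + C\<^sup>2" by (simp add: power2_eq_square algebra_simps)
    show ?thesis unfolding eq using abs_le_D2[OF Ch] unfolding add_divide_distrib by linarith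
  qed
  have 4: "(1 - \<rho>) * C * h \<le> (h\<^sup>2 + C\<^sup>2) / 2"
  proof -
    have "\<bar>(1 - \<rho>) * (C * h)\<bar> \<le> 1 * \<bar>C * h\<bar>"
      unfolding abs_mult[of "1 - \<rho>"] using \<rho> by (intro mult_right_mono) auto
    then have "(1 - \<rho>) * (C * h) \<le> \<bar>C * h\<bar>" using abs_le_D1 by simp
    also note Ch
    finally show ?thesis by (simp only: mult.assoc)
  qed
  have W: "q\<^sup>2 / 4 - 4 * h\<^sup>2 - 4 * C\<^sup>2 - 7 \<le> curvature_poly \<rho> C h"
  proof -
    have comb: "Q / 4 - 4 * H - 4 * K - 7 \<le> x - y - z - w"
      if "Q / 2 - 1 \<le> x" "z \<le> Q / 4 + 6" "y \<le> 7 / 2 * H + 5 / 2 * K" "w \<le> (H + K) / 2" "0 \<le> K" for Q H K x y z w :: real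
      using that by (simp add: field_simps)
    show ?thesis unfolding curvature_poly_def sp by (rule comb[OF 1 2 3 4 zero_le_power2])
  qed
  have far: "1024 * x \<le> q\<^sup>2" if "32 \<le> \<bar>v\<bar>" "x \<le> w\<^sup>2" "q\<^sup>2 = v\<^sup>2 * w\<^sup>2" "0 \<le> x" for v w x
  proof -
    have "1024 \<le> v\<^sup>2" using power_mono[OF that(1), of 2] by simp
    then have "1024 * x \<le> v\<^sup>2 * w\<^sup>2" using that by (intro mult_mono) auto
    then show ?thesis using that by simp
  qed
  have q2: "q\<^sup>2 = h\<^sup>2 * (h - C)\<^sup>2" "q\<^sup>2 = (h - C)\<^sup>2 * h\<^sup>2" by (simp_all add: q_def power_mult_distrib)
  have good: "1 \<le> curvature_poly \<rho> C h" if "1024 * ((h\<^sup>2 + C\<^sup>2) / 8) \<le> q\<^sup>2"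
  proof -
    have "128 * h\<^sup>2 + 128 * C\<^sup>2 \<le> q\<^sup>2" using that by simp
    then show ?thesis using W C2 zero_le_power2[of h] by linarith
  qed
  have penalty: "1 - 9000 * C\<^sup>2 * (indicator {-32..32} h + indicator {C - 32..} h) \<le> (1::real)"
    by simp
  consider "h < -32" | "h > C + 32" | "32 < h" "h < C - 32" | "h \<in> {-32..32}" | "h \<in> {C - 32..}" "h \<le> C + 32"
    by fastforce
  then show ?thesis
  proof cases
    case 1
    then have "0 \<le> (- h) * C" using C by (intro mult_nonneg_nonneg) auto
    then have "h\<^sup>2 + C\<^sup>2 \<le> (h - C)\<^sup>2" by (simp add: power2_eq_square algebra_simps)
    then have "(h\<^sup>2 + C\<^sup>2) / 8 \<le> (h - C)\<^sup>2"
      using zero_le_power2[of h] zero_le_power2[of C] unfolding add_divide_distrib by linarith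
    from far[OF _ this q2(1)] 1 have "1 \<le> curvature_poly \<rho> C h" by (intro good) simp
    then show ?thesis by (rule order_trans[OF penalty])
  next
    case 2
    then have "C\<^sup>2 \<le> h\<^sup>2" using C by (intro power_mono) auto
    then have "(h\<^sup>2 + C\<^sup>2) / 8 \<le> h\<^sup>2" using zero_le_power2[of h] unfolding add_divide_distrib by linarith
    from far[OF _ this q2(2)] 2 have "1 \<le> curvature_poly \<rho> C h" by (intro good) simp
    then show ?thesis by (rule order_trans[OF penalty])
  next
    case 3
    have hC: "h\<^sup>2 \<le> C\<^sup>2" using 3 by (intro power_mono) auto
    have "1024 * ((h\<^sup>2 + C\<^sup>2) / 8) \<le> q\<^sup>2"
    proof (cases "h \<le> C / 2")
      case True
      then have "(C / 2)\<^sup>2 \<le> (C - h)\<^sup>2" using C by (intro power_mono) auto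
      then have "(h\<^sup>2 + C\<^sup>2) / 8 \<le> (h - C)\<^sup>2" using hC by (simp add: power2_commute power_divide)
      from far[OF _ this q2(1)] 3 show ?thesis by simp
    next
      case False
      then have "(C / 2)\<^sup>2 \<le> h\<^sup>2" using C by (intro power_mono) auto
      then have "(h\<^sup>2 + C\<^sup>2) / 8 \<le> h\<^sup>2" using hC by (simp add: power_divide)
      from far[OF _ this q2(2)] 3 show ?thesis by simp
    qed
    then have "1 \<le> curvature_poly \<rho> C h" by (rule good)
    then show ?thesis by (rule order_trans[OF penalty])
  next
    case 4
    then have "\<bar>h\<bar> \<le> 32" by auto
    from power_mono[OF this, of 2] have "h\<^sup>2 \<le> 1024" by simp
    then have *: "1 - 9000 * C\<^sup>2 \<le> curvature_poly \<rho> C h" using W C2 zero_le_power2[of q] by linarith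
    have "9000 * C\<^sup>2 * 1 \<le> 9000 * C\<^sup>2 * (indicator {-32..32} h + indicator {C - 32..} h)"
      using 4 C2 by (intro mult_left_mono) auto
    with * show ?thesis by linarith
  next
    case 5
    then have "\<bar>h\<bar> \<le> C + 32" using C by auto
    from power_mono[OF this, of 2] have "h\<^sup>2 \<le> (C + 32)\<^sup>2" by simp
    moreover have "0 \<le> (C - 32)\<^sup>2" by simp
    ultimately have "h\<^sup>2 \<le> 2 * C\<^sup>2 + 2048" by (simp add: power2_eq_square algebra_simps)
    then have *: "1 - 9000 * C\<^sup>2 \<le> curvature_poly \<rho> C h" using W C2 zero_le_power2[of q] by linarith
    have "9000 * C\<^sup>2 * 1 \<le> 9000 * C\<^sup>2 * (indicator {-32..32} h + indicator {C - 32..} h)"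
      using 5 C2 by (intro mult_left_mono) auto
    with * show ?thesis by linarith
  qed
qed

text \<open>
  Integrating the pointwise bound, the constant 1 contributes \<open>fwer\<close> itself.  In the zone near 0 the penalty is small because
  rejection is unlikely there; in the zone near \<open>c * sqrt \<rho>\<close> and beyond, because the common factor rarely gets there.
\<close>

lemma fwer_curvature_ge:
  assumes \<rho>: "0 < \<rho>" "\<rho> < 1" and c: "0 \<le> c" "1 \<le> c * sqrt \<rho>" and n: "real n * (1 - \<Phi> c) \<le> 1"
  shows "fwer n c \<rho> - 9000 * (c * sqrt \<rho>)\<^sup>2 *
      (sqrt (2 * pi) * exp (c + 1 / 2 + c * critical_slope \<rho> * (32 - critical_slope \<rho> * c))
       + exp (32 * (c * sqrt \<rho>) - (c * sqrt \<rho>)\<^sup>2 / 2))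
    \<le> (\<integral>z. \<phi> z * (rejection_given n c \<rho> z * curvature_poly \<rho> (c * sqrt \<rho>) z) \<partial>lborel)"
proof -
  define C where "C = c * sqrt \<rho>"
  define r where "r = rejection_given n c \<rho>"
  define e where "e = sqrt (2 * pi) * exp (c + 1 / 2 + c * critical_slope \<rho> * (32 - critical_slope \<rho> * c))"
  have [measurable]: "r \<in> borel_measurable borel" by (simp add: r_def)
  have r01: "0 \<le> r z" "r z \<le> 1" for z by (simp_all add: r_def rejection_given_01)
  have C: "1 \<le> C" using c by (simp add: C_def)
  have i1: "integrable lborel (\<lambda>z. \<phi> z * (r z * indicator {-32..32} z))"
    using r01 by (intro integrable_std_normal_times) (auto simp: indicator_def)
  have i2: "integrable lborel (\<lambda>z. \<phi> z * (r z * indicator {C - 32..} z))"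
    using r01 by (intro integrable_std_normal_times) (auto simp: indicator_def)
  have "(\<integral>z. \<phi> z * (r z * indicator {-32..32} z) \<partial>lborel) \<le> (\<integral>z. e * \<phi> z \<partial>lborel)"
  proof (rule integral_mono[OF i1])
    show "\<phi> z * (r z * indicator {-32..32} z) \<le> e * \<phi> z" for z
    proof (cases "z \<in> {-32..32}")
      case True
      have "r z \<le> sqrt (2 * pi) * exp (c + 1 / 2 + c * critical_slope \<rho> * (z - critical_slope \<rho> * c))"
        unfolding r_def by (rule rejection_given_le[OF \<rho> c(1) n])
      also have "\<dots> \<le> e" unfolding e_def
        using True c critical_slope_bounds(1)[OF \<rho>] by (intro mult_left_mono) (auto intro!: mult_left_mono)
      finally have "\<phi> z * r z \<le> \<phi> z * e" by (intro mult_left_mono) auto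
      with True show ?thesis by (simp add: mult.commute)
    qed (simp add: e_def)
  qed simp
  then have z1: "(\<integral>z. \<phi> z * (r z * indicator {-32..32} z) \<partial>lborel) \<le> e" by simp
  have "(\<integral>z. \<phi> z * (r z * indicator {C - 32..} z) \<partial>lborel) \<le> (\<integral>z. \<phi> z * indicator {C - 32..} z \<partial>lborel)"
    using r01 by (intro integral_mono[OF i2] integrable_std_normal_times mult_left_mono) (auto simp: indicator_def)
  also have "\<dots> \<le> exp (C\<^sup>2 / 2 - C * (C - 32))"
    using C by (intro std_normal_chernoff) auto
  also have "C\<^sup>2 / 2 - C * (C - 32) = 32 * C - C\<^sup>2 / 2" by (simp add: power2_eq_square algebra_simps)
  finally have z2: "(\<integral>z. \<phi> z * (r z * indicator {C - 32..} z) \<partial>lborel) \<le> exp (32 * C - C\<^sup>2 / 2)" .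
  have curv: "integrable lborel (\<lambda>z. \<phi> z * (r z * curvature_poly \<rho> C z))"
  proof (rule Bochner_Integration.integrable_bound)
    show "integrable lborel (\<lambda>z. (5 * (1 + C)\<^sup>2) * (\<phi> z + 2 * (\<phi> z * z ^ 2) + \<phi> z * z ^ 4))"
      by (intro integrable_mult_right Bochner_Integration.integrable_add integrable_std_normal_moment integrable_normal_density) simp
    show "AE z in lborel. norm (\<phi> z * (r z * curvature_poly \<rho> C z)) \<le> norm ((5 * (1 + C)\<^sup>2) * (\<phi> z + 2 * (\<phi> z * z ^ 2) + \<phi> z * z ^ 4))"
    proof (intro AE_I2)
      fix z
      have eq: "(5 * (1 + C)\<^sup>2) * (\<phi> z + 2 * (\<phi> z * z ^ 2) + \<phi> z * z ^ 4) = \<phi> z * (5 * (1 + C)\<^sup>2 * (1 + z\<^sup>2)\<^sup>2)"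
        by (simp add: power2_sum algebra_simps power4_eq_xxxx power2_eq_square)
      have "\<bar>r z * curvature_poly \<rho> C z\<bar> \<le> 1 * (5 * (1 + C)\<^sup>2 * (1 + z\<^sup>2)\<^sup>2)"
        unfolding abs_mult using r01[of z] C by (intro mult_mono curvature_poly_bound \<rho>) auto
      then have "\<phi> z * \<bar>r z * curvature_poly \<rho> C z\<bar> \<le> \<phi> z * (5 * (1 + C)\<^sup>2 * (1 + z\<^sup>2)\<^sup>2)"
        by (intro mult_left_mono) auto
      then show "norm (\<phi> z * (r z * curvature_poly \<rho> C z)) \<le> norm ((5 * (1 + C)\<^sup>2) * (\<phi> z + 2 * (\<phi> z * z ^ 2) + \<phi> z * z ^ 4))"
        unfolding eq real_norm_def abs_mult[of "\<phi> z"] by simp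
    qed
  qed measurable
  have "fwer n c \<rho> - 9000 * C\<^sup>2 * (e + exp (32 * C - C\<^sup>2 / 2))
     \<le> fwer n c \<rho> - 9000 * C\<^sup>2 * ((\<integral>z. \<phi> z * (r z * indicator {-32..32} z) \<partial>lborel) + (\<integral>z. \<phi> z * (r z * indicator {C - 32..} z) \<partial>lborel))"
    using z1 z2 by (intro diff_left_mono mult_left_mono add_mono) auto
  also have "\<dots> = (\<integral>z. \<phi> z * r z - 9000 * C\<^sup>2 * (\<phi> z * (r z * indicator {-32..32} z) + \<phi> z * (r z * indicator {C - 32..} z)) \<partial>lborel)"
    using i1 i2 integrable_rejection_given[of n c \<rho>] by (simp add: fwer_def r_def)
  also have "\<dots> \<le> (\<integral>z. \<phi> z * (r z * curvature_poly \<rho> C z) \<partial>lborel)"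
  proof (rule integral_mono[OF _ curv])
    show "integrable lborel (\<lambda>z. \<phi> z * r z - 9000 * C\<^sup>2 * (\<phi> z * (r z * indicator {-32..32} z) + \<phi> z * (r z * indicator {C - 32..} z)))"
      using i1 i2 integrable_rejection_given[of n c \<rho>] unfolding r_def
      by (intro Bochner_Integration.integrable_diff Bochner_Integration.integrable_add integrable_mult_right)
    fix z
    have "(\<phi> z * r z) * (1 - 9000 * C\<^sup>2 * (indicator {-32..32} z + indicator {C - 32..} z)) \<le> (\<phi> z * r z) * curvature_poly \<rho> C z"
      using r01 by (intro mult_left_mono curvature_poly_ge \<rho> C) auto
    then show "\<phi> z * r z - 9000 * C\<^sup>2 * (\<phi> z * (r z * indicator {-32..32} z) + \<phi> z * (r z * indicator {C - 32..} z))
       \<le> \<phi> z * (r z * curvature_poly \<rho> C z)"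
      by (simp add: algebra_simps)
  qed
  finally show ?thesis by (simp add: C_def e_def r_def)
qed


lemma gaussian_beats_polynomial:
  fixes D d e :: real
  assumes "0 < D"
  shows "((\<lambda>x. x\<^sup>2 * exp (d * x + e - D * x\<^sup>2)) \<longlongrightarrow> 0) at_top"
  using assms by real_asymp

lemma equicorrelated_acceptance_probability:
  assumes X: "equicorrelated_std_normal M n \<rho> X" and \<rho>: "0 \<le> \<rho>" "\<rho> < 1"
  shows "measure M {w \<in> space M. \<forall>i\<in>{1..n}. X i w \<le> c} = 1 - fwer n c \<rho>"
proof -
  have acc: "\<Phi> ((c - sqrt \<rho> * z) / sqrt (1 - \<rho>)) ^ n = 1 - rejection_given n c \<rho> z" for z
    by (simp add: rejection_given_def)
  have "measure M {w \<in> space M. \<forall>i\<in>{1..n}. X i w \<le> c} = (\<integral>z. 1 - rejection_given n c \<rho> z \<partial>gauss)"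
    unfolding equicorrelated_orthant_probability[OF assms] acc ..
  also have "\<dots> = (\<integral>z. \<phi> z * (1 - rejection_given n c \<rho> z) \<partial>lborel)"
    by (rule integral_std_normal) measurable
  also have "\<dots> = (\<integral>z. \<phi> z - \<phi> z * rejection_given n c \<rho> z \<partial>lborel)"
    by (simp add: right_diff_distrib)
  also have "\<dots> = 1 - fwer n c \<rho>"
    unfolding fwer_def using integrable_rejection_given by (subst Bochner_Integration.integral_diff) auto
  finally show ?thesis .
qed

lemma fwer_twice_differentiable:
  "\<exists>D. \<forall>\<rho>\<in>{0<..<1}. (fwer n c has_real_derivative D \<rho>) (at \<rho>) \<and>
      (D has_real_derivative
        (\<integral>z. \<phi> z * (rejection_given n c \<rho> z * curvature_poly \<rho> (c * sqrt \<rho>) z) \<partial>lborel)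
          / (2 * \<rho> * (1 - \<rho>))\<^sup>2) (at \<rho>)"
proof -
  define g where "g u = 1 - \<Phi> u ^ n" for u
  have [measurable]: "g \<in> borel_measurable borel" unfolding g_def[abs_def] by measurable
  have g01: "0 \<le> g u" "g u \<le> 1" for u
    unfolding g_def using std_normal_cdf_01 by (auto intro: power_le_one)
  have rg: "rejection_given n c \<rho> z = g ((c - sqrt \<rho> * z) / sqrt (1 - \<rho>))" for \<rho> z
    by (simp add: rejection_given_def g_def)
  define D where "D \<rho> = (\<integral>u. g u * (mixing_density c \<rho> u * (score_poly (c * sqrt \<rho>) (mixing_point c \<rho> u) / (2 * \<rho> * (1 - \<rho>)))) \<partial>lborel)" for \<rho>
  note twice = mixture_twice_differentiable[OF \<open>g \<in> borel_measurable borel\<close> g01, of _ c, folded D_def]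
  have mix: "(\<integral>u. g u * mixing_density c \<rho> u \<partial>lborel) = fwer n c \<rho>" if "0 < \<rho>" "\<rho> < 1" for \<rho>
    using integral_change_to_mixing_density[OF that, of "\<lambda>_ u. g u" c]
    by (simp add: fwer_def rg mult.commute)
  have curv: "(\<integral>u. g u * (mixing_density c \<rho> u * (curvature_poly \<rho> (c * sqrt \<rho>) (mixing_point c \<rho> u) / (2 * \<rho> * (1 - \<rho>))\<^sup>2)) \<partial>lborel)
     = (\<integral>z. \<phi> z * (rejection_given n c \<rho> z * curvature_poly \<rho> (c * sqrt \<rho>) z) \<partial>lborel) / (2 * \<rho> * (1 - \<rho>))\<^sup>2"
    if "0 < \<rho>" "\<rho> < 1" for \<rho>
    using integral_change_to_mixing_density[OF that, of "\<lambda>z u. g u * curvature_poly \<rho> (c * sqrt \<rho>) z / (2 * \<rho> * (1 - \<rho>))\<^sup>2" c, symmetric]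
    by (simp add: rg mult_ac)
  show ?thesis
  proof (intro exI[of _ D] ballI conjI)
    fix \<rho> :: real assume "\<rho> \<in> {0<..<1}"
    then have \<rho>: "0 < \<rho>" "\<rho> < 1" by auto
    show "(fwer n c has_real_derivative D \<rho>) (at \<rho>)"
    proof (rule has_field_derivative_transform_within_open[OF twice(1)[OF \<rho>], of "{0<..<1}"])
    qed (use \<rho> mix in auto)
    show "(D has_real_derivative
        (\<integral>z. \<phi> z * (rejection_given n c \<rho> z * curvature_poly \<rho> (c * sqrt \<rho>) z) \<partial>lborel)
          / (2 * \<rho> * (1 - \<rho>))\<^sup>2) (at \<rho>)"
      using twice(2)[OF \<rho>] unfolding curv[OF \<rho>] .
  qed
qed

text \<open>
  Divided by \<open>E = exp (- (\<kappa> * c + 1)\<^sup>2 / 2)\<close>, the order of the lower bound of \<open>fwer\<close>, the two penalties have exponents with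
  leading terms \<open>- \<kappa>\<^sup>2 / 2 * c\<^sup>2\<close> and \<open>- (\<rho> - \<kappa>\<^sup>2) / 2 * c\<^sup>2\<close>.  Both are negative, so the penalties vanish in the limit.
  The bound is uniform in all \<open>n\<close> that match the threshold \<open>c\<close>.
\<close>

lemma eventually_fwer_curvature_nonneg:
  assumes \<rho>: "0 < \<rho>" "\<rho> < 1" and \<beta>: "0 < \<beta>"
  shows "\<forall>\<^sub>F c in at_top. \<forall>n. \<beta> \<le> real n * (1 - \<Phi> c) \<longrightarrow> real n * (1 - \<Phi> c) \<le> 1 \<longrightarrow>
     0 \<le> (\<integral>z. \<phi> z * (rejection_given n c \<rho> z * curvature_poly \<rho> (c * sqrt \<rho>) z) \<partial>lborel)"
proof -
  define \<kappa> q where "\<kappa> = critical_slope \<rho>" and "q = sqrt \<rho>"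
  have \<kappa>: "0 < \<kappa>" "\<kappa> < q" and q: "0 < q"
    using critical_slope_bounds[OF \<rho>] \<rho> by (auto simp: \<kappa>_def q_def)
  have \<kappa>q: "\<kappa>\<^sup>2 < q\<^sup>2" using \<kappa> by (intro power_strict_mono) auto
  define \<epsilon> where "\<epsilon> = (1 - exp (- \<beta>)) / sqrt (2 * pi)"
  have \<epsilon>: "0 < \<epsilon>" using \<beta> by (simp add: \<epsilon>_def)
  define L where "L c = 9000 * q\<^sup>2 * sqrt (2 * pi) * (c\<^sup>2 * exp ((1 + 33 * \<kappa>) * c + 1 - \<kappa>\<^sup>2 / 2 * c\<^sup>2))
      + 9000 * q\<^sup>2 * (c\<^sup>2 * exp ((32 * q + \<kappa>) * c + 1 / 2 - (q\<^sup>2 - \<kappa>\<^sup>2) / 2 * c\<^sup>2))" for c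
  have "(L \<longlongrightarrow> 9000 * q\<^sup>2 * sqrt (2 * pi) * 0 + 9000 * q\<^sup>2 * 0) at_top"
    unfolding L_def[abs_def] using \<kappa> \<kappa>q by (intro tendsto_intros gaussian_beats_polynomial) auto
  then have "\<forall>\<^sub>F c in at_top. L c < \<epsilon>" using \<epsilon> by (intro order_tendstoD) auto
  moreover have "\<forall>\<^sub>F c in at_top. 1 / q \<le> c" by (rule eventually_ge_at_top)
  ultimately show ?thesis
  proof eventually_elim
    case (elim c)
    have cq: "1 \<le> c * q" using elim q by (simp add: pos_divide_le_eq)
    have c: "0 \<le> c" using elim(2) q by (smt (verit) divide_pos_pos)
    show ?case
    proof (intro allI impI)
      fix n assume n: "\<beta> \<le> real n * (1 - \<Phi> c)" "real n * (1 - \<Phi> c) \<le> 1"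
      define E where "E = exp (- (\<kappa> * c + 1)\<^sup>2 / 2)"
      have "9000 * (c * q)\<^sup>2 * (sqrt (2 * pi) * exp (c + 1 / 2 + c * \<kappa> * (32 - \<kappa> * c)) + exp (32 * (c * q) - (c * q)\<^sup>2 / 2))
          = L c * E"
      proof -
        have e1: "exp (c + 1 / 2 + c * \<kappa> * (32 - \<kappa> * c)) = exp ((1 + 33 * \<kappa>) * c + 1 - \<kappa>\<^sup>2 / 2 * c\<^sup>2) * E"
          unfolding E_def exp_add[symmetric] by (simp add: power2_eq_square field_simps)
        have e2: "exp (32 * (c * q) - (c * q)\<^sup>2 / 2) = exp ((32 * q + \<kappa>) * c + 1 / 2 - (q\<^sup>2 - \<kappa>\<^sup>2) / 2 * c\<^sup>2) * E"
          unfolding E_def exp_add[symmetric] by (simp add: power2_eq_square field_simps)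
        show ?thesis unfolding e1 e2 L_def by (simp add: power_mult_distrib algebra_simps)
      qed
      also have "\<dots> \<le> \<epsilon> * E" using elim(1) by (intro mult_right_mono) (auto simp: E_def)
      also have "\<dots> = (1 - exp (- \<beta>)) * \<phi> (\<kappa> * c + 1)"
        by (simp add: \<epsilon>_def E_def std_normal_density_def)
      also have "\<dots> \<le> fwer n c \<rho>"
        unfolding \<kappa>_def using \<rho> \<beta> c n by (intro fwer_ge) auto
      finally show "0 \<le> (\<integral>z. \<phi> z * (rejection_given n c \<rho> z * curvature_poly \<rho> (c * sqrt \<rho>) z) \<partial>lborel)"
        using fwer_curvature_ge[OF \<rho> c cq[unfolded q_def] n(2)] by (simp add: \<kappa>_def q_def)
    qed
  qed
qed

text \<open>
  The Gaussian rates \<open>\<kappa>\<^sup>2 / 2\<close> of \<open>fwer\<close> at different correlations differ, since the critical slope is strictly increasing.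
  The factor \<open>c\<^sup>2 \<ge> 1\<close> is inserted only to reuse \<open>gaussian_beats_polynomial\<close>.
\<close>

lemma eventually_fwer_negligible:
  assumes \<rho>: "0 \<le> \<rho>" "\<rho> < \<rho>'" "\<rho>' < 1" and \<beta>: "0 < \<beta>" and t: "0 < t"
  shows "\<forall>\<^sub>F c in at_top. \<forall>n. \<beta> \<le> real n * (1 - \<Phi> c) \<longrightarrow> real n * (1 - \<Phi> c) \<le> 1 \<longrightarrow>
     fwer n c \<rho>' \<le> t * fwer n c \<rho>"
proof -
  define \<kappa> \<kappa>' where "\<kappa> = critical_slope \<rho>" and "\<kappa>' = critical_slope \<rho>'"
  have \<kappa>: "0 \<le> \<kappa>" "\<kappa> < \<kappa>'"
    using critical_slope_strict_mono[OF \<rho>] \<rho> by (auto simp: \<kappa>_def \<kappa>'_def critical_slope_def)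
  have \<kappa>\<kappa>: "\<kappa>\<^sup>2 < \<kappa>'\<^sup>2" using \<kappa> by (intro power_strict_mono) auto
  define \<epsilon> where "\<epsilon> = t * (1 - exp (- \<beta>)) / sqrt (2 * pi)"
  have \<epsilon>: "0 < \<epsilon>" using \<beta> t by (simp add: \<epsilon>_def)
  define L where "L c = sqrt (2 * pi) * (c\<^sup>2 * exp ((1 + \<kappa>) * c + 1 - (\<kappa>'\<^sup>2 - \<kappa>\<^sup>2) / 2 * c\<^sup>2))" for c
  have "(L \<longlongrightarrow> sqrt (2 * pi) * 0) at_top"
    unfolding L_def[abs_def] using \<kappa>\<kappa> by (intro tendsto_intros gaussian_beats_polynomial) auto
  then have "\<forall>\<^sub>F c in at_top. L c < \<epsilon>" using \<epsilon> by (intro order_tendstoD) auto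
  moreover have "\<forall>\<^sub>F c in at_top. 1 \<le> (c::real)" by (rule eventually_ge_at_top)
  ultimately show ?thesis
  proof eventually_elim
    case (elim c)
    then have c: "0 \<le> c" "1 \<le> c\<^sup>2" by (simp_all add: one_le_power)
    show ?case
    proof (intro allI impI)
      fix n assume n: "\<beta> \<le> real n * (1 - \<Phi> c)" "real n * (1 - \<Phi> c) \<le> 1"
      define E where "E = exp (- (\<kappa> * c + 1)\<^sup>2 / 2)"
      have "fwer n c \<rho>' \<le> sqrt (2 * pi) * (1 * exp (c + 1 / 2 - (\<kappa>' * c)\<^sup>2 / 2))"
        unfolding \<kappa>'_def using fwer_le[of \<rho>' c n] \<rho> c n by simp
      also have "\<dots> \<le> sqrt (2 * pi) * (c\<^sup>2 * exp (c + 1 / 2 - (\<kappa>' * c)\<^sup>2 / 2))"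
        using c by (intro mult_left_mono mult_right_mono) auto
      also have "exp (c + 1 / 2 - (\<kappa>' * c)\<^sup>2 / 2) = exp ((1 + \<kappa>) * c + 1 - (\<kappa>'\<^sup>2 - \<kappa>\<^sup>2) / 2 * c\<^sup>2) * E"
        unfolding E_def exp_add[symmetric] by (simp add: power2_eq_square field_simps)
      also have "sqrt (2 * pi) * (c\<^sup>2 * (exp ((1 + \<kappa>) * c + 1 - (\<kappa>'\<^sup>2 - \<kappa>\<^sup>2) / 2 * c\<^sup>2) * E)) = L c * E"
        by (simp add: L_def)
      also have "\<dots> \<le> \<epsilon> * E" using elim(1) by (intro mult_right_mono) (auto simp: E_def)
      also have "\<dots> = t * ((1 - exp (- \<beta>)) * \<phi> (\<kappa> * c + 1))"
        by (simp add: \<epsilon>_def E_def std_normal_density_def)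
      also have "\<dots> \<le> t * fwer n c \<rho>"
        unfolding \<kappa>_def using \<rho> \<beta> c n t by (intro mult_left_mono fwer_ge) auto
      finally show "fwer n c \<rho>' \<le> t * fwer n c \<rho>" .
    qed
  qed
qed

section \<open>Asymptotic concavity\<close>

theorem theorem3p1:
  fixes \<alpha>s :: "nat \<Rightarrow> real" and \<alpha> :: real and c :: "nat \<Rightarrow> real"
    and M :: "nat \<Rightarrow> real \<Rightarrow> 'a measure"
    and X :: "nat \<Rightarrow> real \<Rightarrow> nat \<Rightarrow> 'a \<Rightarrow> real"
    and H :: "nat \<Rightarrow> real \<Rightarrow> real"
  assumes "\<And>n. n \<ge> 1 \<Longrightarrow> \<alpha>s n \<in> {0<..<1}"
    and "(\<lambda>n. real n * \<alpha>s n) \<longlonglongrightarrow> \<alpha>"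
    and "\<alpha> \<in> {0<..<1}"
    and "\<And>n. n \<ge> 1 \<Longrightarrow> cdf std_normal_distribution (- c n) = \<alpha>s n"
    and "\<And>n \<rho>. n \<ge> 1 \<Longrightarrow> \<rho> \<in> {0..1} \<Longrightarrow> equicorrelated_std_normal (M n \<rho>) n \<rho> (X n \<rho>)"
    and "\<And>n \<rho>. n \<ge> 1 \<Longrightarrow> \<rho> \<in> {0..1} \<Longrightarrow>
           H n \<rho> = measure (M n \<rho>) {\<omega> \<in> space (M n \<rho>). \<forall>i\<in>{1..n}. X n \<rho> i \<omega> \<le> c n}"
  shows "(\<forall>\<rho>\<in>{0<..<1}. \<exists>N. \<forall>n\<ge>N.
            (\<forall>\<^sub>F x in nhds \<rho>. H n differentiable at x) \<and>
            deriv (H n) differentiable at \<rho> \<and>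
            deriv (deriv (H n)) \<rho> \<le> 0) \<and>
         (\<forall>\<rho>\<^sub>1\<in>{0..1}. \<forall>\<rho>\<^sub>2\<in>{0..1}. \<forall>t\<in>{0..1}. \<exists>N. \<forall>n\<ge>N.
            H n (t * \<rho>\<^sub>1 + (1 - t) * \<rho>\<^sub>2) \<ge> t * H n \<rho>\<^sub>1 + (1 - t) * H n \<rho>\<^sub>2)"
proof -
  note lim = assms(2) and \<alpha> = assms(3)
  have level: "1 - \<Phi> (c n) = \<alpha>s n" if "1 \<le> n" for n
    using assms(4)[OF that] by (simp add: std_normal_cdf_minus)
  have H: "H n \<rho> = 1 - fwer n (c n) \<rho>" if "1 \<le> n" "0 \<le> \<rho>" "\<rho> < 1" for n \<rho>
    using equicorrelated_acceptance_probability[OF assms(5)[of n \<rho>]] assms(6)[of n \<rho>] that by simp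
  have H1: "H n \<rho> \<le> 1" if "1 \<le> n" "\<rho> \<in> {0..1}" for n \<rho>
  proof -
    interpret prob_space "M n \<rho>" using assms(5)[OF that] by (simp add: equicorrelated_std_normal_def)
    show ?thesis using assms(6)[OF that] by simp
  qed
  have "(\<lambda>n. (real n * \<alpha>s n) * (1 / real n)) \<longlonglongrightarrow> \<alpha> * 0"
    by (intro tendsto_mult lim lim_1_over_n)
  then have "\<alpha>s \<longlonglongrightarrow> \<alpha> * 0"
    by (rule Lim_transform_eventually) (auto simp: eventually_sequentially intro!: exI[of _ 1])
  then have \<alpha>s0: "\<alpha>s \<longlonglongrightarrow> 0" by simp
  (* the levels tend to 0 while the Gaussian tail beyond any fixed B is positive *)
  have c: "filterlim c at_top sequentially"
    unfolding filterlim_at_top_ge[of _ _ 0]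
  proof (intro allI impI)
    fix B :: real assume B: "0 \<le> B"
    have "0 < \<phi> (B + 1)" by (simp add: normal_density_pos)
    then have "0 < 1 - \<Phi> B" using std_normal_tail_lower[OF B] by linarith
    then have "\<forall>\<^sub>F n in sequentially. \<alpha>s n < 1 - \<Phi> B" by (rule order_tendstoD(2)[OF \<alpha>s0])
    then show "\<forall>\<^sub>F n in sequentially. B \<le> c n"
      using eventually_ge_at_top[of 1]
    proof eventually_elim
      case (elim n)
      then show ?case using level[of n] std_normal_cdf_mono[of "c n" B] by linarith
    qed
  qed
  have size: "\<forall>\<^sub>F n in sequentially. 1 \<le> n \<and> \<alpha> / 2 \<le> real n * (1 - \<Phi> (c n)) \<and> real n * (1 - \<Phi> (c n)) \<le> 1"
  proof -
    have "\<forall>\<^sub>F n in sequentially. \<alpha> / 2 < real n * \<alpha>s n" "\<forall>\<^sub>F n in sequentially. real n * \<alpha>s n < 1"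
      using order_tendstoD(1)[OF lim, of "\<alpha> / 2"] order_tendstoD(2)[OF lim, of 1] \<alpha> by simp_all
    then show ?thesis using eventually_ge_at_top[of 1]
      by eventually_elim (simp add: level)
  qed
  have curvature: "\<exists>N. \<forall>n\<ge>N. (\<forall>\<^sub>F x in nhds \<rho>. H n differentiable at x) \<and>
            deriv (H n) differentiable at \<rho> \<and> deriv (deriv (H n)) \<rho> \<le> 0" if \<rho>: "\<rho> \<in> {0<..<1}" for \<rho>
    unfolding eventually_sequentially[symmetric]
  proof -
    have r: "0 < \<rho>" "\<rho> < 1" using \<rho> by auto
    have "\<forall>\<^sub>F n in sequentially. \<forall>m. \<alpha> / 2 \<le> real m * (1 - \<Phi> (c n)) \<longrightarrow> real m * (1 - \<Phi> (c n)) \<le> 1 \<longrightarrow>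
       0 \<le> (\<integral>z. \<phi> z * (rejection_given m (c n) \<rho> z * curvature_poly \<rho> (c n * sqrt \<rho>) z) \<partial>lborel)"
      using \<alpha> by (intro eventually_compose_filterlim[OF eventually_fwer_curvature_nonneg[OF r] c]) simp
    with size show "\<forall>\<^sub>F n in sequentially. (\<forall>\<^sub>F x in nhds \<rho>. H n differentiable at x) \<and>
            deriv (H n) differentiable at \<rho> \<and> deriv (deriv (H n)) \<rho> \<le> 0"
    proof eventually_elim
      case (elim n)
      then have n: "1 \<le> n" by simp
      obtain D where D: "\<forall>\<rho>\<in>{0<..<1}. (fwer n (c n) has_real_derivative D \<rho>) (at \<rho>) \<and>
        (D has_real_derivative
          (\<integral>z. \<phi> z * (rejection_given n (c n) \<rho> z * curvature_poly \<rho> (c n * sqrt \<rho>) z) \<partial>lborel)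
          / (2 * \<rho> * (1 - \<rho>))\<^sup>2) (at \<rho>)"
        using fwer_twice_differentiable[of n "c n"] ..
      define J where "J = (\<integral>z. \<phi> z * (rejection_given n (c n) \<rho> z * curvature_poly \<rho> (c n * sqrt \<rho>) z) \<partial>lborel)
          / (2 * \<rho> * (1 - \<rho>))\<^sup>2"
      have J: "0 \<le> J" unfolding J_def using elim by (intro divide_nonneg_nonneg) auto
      have D1: "(H n has_real_derivative - D x) (at x)" if x: "x \<in> {0<..<1}" for x
      proof (rule has_field_derivative_transform_within_open[of "\<lambda>x. 1 - fwer n (c n) x" _ _ "{0<..<1}"])
        show "((\<lambda>x. 1 - fwer n (c n) x) has_real_derivative - D x) (at x)"
          using DERIV_diff[OF DERIV_const conjunct1[OF bspec[OF D x]]] by simp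
      qed (use x H[OF n] in auto)
      have D2: "(deriv (H n) has_real_derivative - J) (at \<rho>)"
      proof (rule has_field_derivative_transform_within_open[of "\<lambda>x. - D x" _ _ "{0<..<1}"])
        show "((\<lambda>x. - D x) has_real_derivative - J) (at \<rho>)"
          unfolding J_def by (intro DERIV_minus conjunct2[OF bspec[OF D \<rho>]])
        show "- D x = deriv (H n) x" if "x \<in> {0<..<1}" for x
          using DERIV_imp_deriv[OF D1[OF that]] by simp
      qed (use r in auto)
      have "\<forall>\<^sub>F x in nhds \<rho>. x \<in> {0<..<1}" using \<rho> by (intro eventually_nhds_in_open) auto
      then have "\<forall>\<^sub>F x in nhds \<rho>. H n differentiable at x"
        by eventually_elim (use D1 real_differentiable_def in blast)
      moreover have "deriv (H n) differentiable at \<rho>" using D2 real_differentiable_def by blast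
      moreover have "deriv (deriv (H n)) \<rho> \<le> 0" using DERIV_imp_deriv[OF D2] J by simp
      ultimately show ?case by simp
    qed
  qed
  have chord: "\<forall>\<^sub>F n in sequentially. t * H n a + (1 - t) * H n b \<le> H n (t * a + (1 - t) * b)"
    if ab: "0 \<le> a" "a < b" "b \<le> 1" and t: "0 < t" "t < 1" for a b t
  proof -
    define m where "m = t * a + (1 - t) * b"
    have "m - a = (1 - t) * (b - a)" "b - m = t * (b - a)" by (simp_all add: m_def algebra_simps)
    then have m: "a < m" "m < 1" using ab t by (smt (verit) mult_pos_pos)+
    have "\<forall>\<^sub>F n in sequentially. \<forall>k. \<alpha> / 2 \<le> real k * (1 - \<Phi> (c n)) \<longrightarrow> real k * (1 - \<Phi> (c n)) \<le> 1 \<longrightarrow>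
       fwer k (c n) m \<le> t * fwer k (c n) a"
      using \<alpha> by (intro eventually_compose_filterlim[OF eventually_fwer_negligible[OF ab(1) m] c] t) simp
    with size show ?thesis
    proof eventually_elim
      case (elim n)
      then have n: "1 \<le> n" and f: "fwer n (c n) m \<le> t * fwer n (c n) a" by auto
      (* the trivial bound at b suffices, and covers b = 1, where the one-factor formula degenerates *)
      have "t * H n a + (1 - t) * H n b \<le> t * H n a + (1 - t) * 1"
        using H1[OF n, of b] ab t by (intro add_left_mono mult_left_mono) auto
      also have "\<dots> = 1 - t * fwer n (c n) a" using H[OF n, of a] ab by (simp add: right_diff_distrib)
      also have "\<dots> \<le> H n m" using H[OF n, of m] ab m f by simp
      finally show ?case by (simp add: m_def)
    qed
  qed
  have concave: "\<exists>N. \<forall>n\<ge>N. t * H n \<rho>\<^sub>1 + (1 - t) * H n \<rho>\<^sub>2 \<le> H n (t * \<rho>\<^sub>1 + (1 - t) * \<rho>\<^sub>2)"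
    if "\<rho>\<^sub>1 \<in> {0..1}" "\<rho>\<^sub>2 \<in> {0..1}" "t \<in> {0..1}" for \<rho>\<^sub>1 \<rho>\<^sub>2 t
    unfolding eventually_sequentially[symmetric]
  proof -
    consider "t = 0 \<or> t = 1 \<or> \<rho>\<^sub>1 = \<rho>\<^sub>2" | "0 < t" "t < 1" "\<rho>\<^sub>1 < \<rho>\<^sub>2" | "0 < t" "t < 1" "\<rho>\<^sub>2 < \<rho>\<^sub>1"
      using \<open>t \<in> {0..1}\<close> by fastforce
    then show "\<forall>\<^sub>F n in sequentially. t * H n \<rho>\<^sub>1 + (1 - t) * H n \<rho>\<^sub>2 \<le> H n (t * \<rho>\<^sub>1 + (1 - t) * \<rho>\<^sub>2)"
    proof cases
      case 1
      then have "t * H n \<rho>\<^sub>1 + (1 - t) * H n \<rho>\<^sub>2 = H n (t * \<rho>\<^sub>1 + (1 - t) * \<rho>\<^sub>2)" for n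
        by (auto simp: algebra_simps)
      then show ?thesis by simp
    next
      case 2
      then show ?thesis using that by (intro chord) auto
    next
      case 3
      then show ?thesis using chord[of \<rho>\<^sub>2 \<rho>\<^sub>1 "1 - t"] that by (simp add: add.commute)
    qed
  qed
  show ?thesis using curvature concave by blast
qed

end
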